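(* Let $k>0$ be fixed and let $p=p(n)\in[0,1]$ satisfy $p\gg n^{-1+k}$, i.e. $n^{-1+k}/p(n)\to0$ as $n\to\infty$. Then the stationary distribution of (the random walk on) $\overrightarrow{G}(n,p)$ converges, asymptotically almost surely, to the uniform distribution under the chi-squared norm; that is, with $\mathbf{u}_n=(1/n,\dots,1/n)$ and $\phi$ the stationary distribution of the random walk on $\overrightarrow{G}(n,p)$, for every $\delta>0$ the probability that the random walk on $\overrightarrow{G}(n,p)$ is irreducible and ergodic and $\|\phi-\mathbf{u}_n\|_{2,\mathbf{u}_n}>\delta$ tends to $0$ as $n\to\infty$.
   Context: $\overrightarrow{G}(n,p)$ is the random directed graph on vertices $1,\dots,n$ in which, for each ordered pair $(i,j)$ of distinct vertices, the arc $i\to j$ is present with probability $p$, independently over all ordered pairs. The random walk on a directed graph (with all out-degrees positive) moves from $i$ to $j$ with probability $1/d_i^{out}$ if $i\to j$ is an arc and $0$ otherwise, where $d_i^{out}$ is the out-degree of $i$. The chi-squared norm with respect to a positive probability vector $\psi$ is $\|\mathbf{x}\|_{2,\psi}=\left(\sum_i\mathbf{x}_i^2/\psi_i\right)^{1/2}$. Standing assumption: Markov chains considered are irreducible and ergodic, so that the stationary distribution exists and is unique. *)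

theory Defs
  imports "HOL-Probability.Probability" "Graph_Theory.Digraph"
begin

text \<open>
  The parameter \<open>p\<close> is meant to lie in \<open>[0,1]\<close>. The library's digraphs carry an abstract type
  of arcs; here an arc is the ordered pair of its ends, and the graph has no loops.
\<close>

definition random_digraph :: "nat \<Rightarrow> real \<Rightarrow> (nat, nat \<times> nat) pre_digraph pmf" where
  "random_digraph n p =
     map_pmf (\<lambda>X. \<lparr>verts = {1..n}, arcs = {e. X e}, tail = fst, head = snd\<rparr>)
       (Pi_pmf {(i, j). i \<in> {1..n} \<and> j \<in> {1..n} \<and> i \<noteq> j} False (\<lambda>_. bernoulli_pmf p))"

definition random_walk :: "('a, 'b) pre_digraph \<Rightarrow> 'a \<Rightarrow> 'a \<Rightarrow> real" where
  "random_walk G i j = (if (i, j) \<in> arcs_ends G then 1 / real (out_degree G i) else 0)"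

definition markov_chain :: "'a set \<Rightarrow> ('a \<Rightarrow> 'a \<Rightarrow> real) \<Rightarrow> bool" where
  "markov_chain S P \<longleftrightarrow> finite S \<and> S \<noteq> {} \<and>
     (\<forall>i\<in>S. \<forall>j\<in>S. 0 \<le> P i j) \<and> (\<forall>i\<in>S. (\<Sum>j\<in>S. P i j) = 1)"

primrec step_prob :: "'a set \<Rightarrow> ('a \<Rightarrow> 'a \<Rightarrow> real) \<Rightarrow> nat \<Rightarrow> 'a \<Rightarrow> 'a \<Rightarrow> real" where
  "step_prob S P 0 i j = (if i = j then 1 else 0)"
| "step_prob S P (Suc m) i j = (\<Sum>k\<in>S. P i k * step_prob S P m k j)"

definition irreducible_chain :: "'a set \<Rightarrow> ('a \<Rightarrow> 'a \<Rightarrow> real) \<Rightarrow> bool" where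
  "irreducible_chain S P \<longleftrightarrow> (\<forall>i\<in>S. \<forall>j\<in>S. \<exists>m. step_prob S P m i j > 0)"

definition aperiodic_chain :: "'a set \<Rightarrow> ('a \<Rightarrow> 'a \<Rightarrow> real) \<Rightarrow> bool" where
  "aperiodic_chain S P \<longleftrightarrow> (\<forall>i\<in>S. Gcd {m. 0 < m \<and> step_prob S P m i i > 0} = 1)"

text \<open>
  For \<^term>\<open>random_walk G\<close> on a simple digraph, \<^const>\<open>markov_chain\<close> demands that all out-degrees
  be positive: the row of a vertex without outgoing arcs sums to \<open>0\<close>. A finite irreducible chain
  is positive recurrent, so ergodicity adds only aperiodicity.
\<close>

definition irreducible_ergodic :: "'a set \<Rightarrow> ('a \<Rightarrow> 'a \<Rightarrow> real) \<Rightarrow> bool" where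
  "irreducible_ergodic S P \<longleftrightarrow> markov_chain S P \<and> irreducible_chain S P \<and> aperiodic_chain S P"

text \<open>Vanishing outside the state space makes a stationary distribution unique as a function.\<close>

definition is_stationary :: "'a set \<Rightarrow> ('a \<Rightarrow> 'a \<Rightarrow> real) \<Rightarrow> ('a \<Rightarrow> real) \<Rightarrow> bool" where
  "is_stationary S P \<phi> \<longleftrightarrow>
     (\<forall>i\<in>S. 0 \<le> \<phi> i) \<and> (\<forall>i. i \<notin> S \<longrightarrow> \<phi> i = 0) \<and> (\<Sum>i\<in>S. \<phi> i) = 1 \<and>
     (\<forall>j\<in>S. (\<Sum>i\<in>S. \<phi> i * P i j) = \<phi> j)"

definition stationary_distribution :: "'a set \<Rightarrow> ('a \<Rightarrow> 'a \<Rightarrow> real) \<Rightarrow> 'a \<Rightarrow> real" where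
  "stationary_distribution S P = (THE \<phi>. is_stationary S P \<phi>)"

definition chi_squared_norm :: "'a set \<Rightarrow> ('a \<Rightarrow> real) \<Rightarrow> ('a \<Rightarrow> real) \<Rightarrow> real" where
  "chi_squared_norm S \<psi> x = sqrt (\<Sum>i\<in>S. (x i)\<^sup>2 / \<psi> i)"

text \<open>
  Existence and uniqueness for irreducible chains, which justify the definite description
  in \<^const>\<open>stationary_distribution\<close>.
\<close>

lemma finite_convergent_subsequence:
  fixes a :: "nat \<Rightarrow> 'a \<Rightarrow> real"
  assumes "finite S" "\<And>n i. i \<in> S \<Longrightarrow> a n i \<in> {0..1}"
  shows "\<exists>r l. strict_mono r \<and> (\<forall>i\<in>S. (\<lambda>n. a (r n) i) \<longlonglongrightarrow> l i)"
  using assms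
proof (induction S rule: finite_induct)
  case empty
  show ?case by (rule exI[of _ id]) (auto simp: strict_mono_def)
next
  case (insert x S)
  then obtain r l where r: "strict_mono r" "\<forall>i\<in>S. (\<lambda>n. a (r n) i) \<longlonglongrightarrow> l i"
    by auto
  have "seq_compact {0..1::real}"
    by (simp add: compact_imp_seq_compact)
  moreover have "\<forall>n. a (r n) x \<in> {0..1}" using insert.prems by blast
  ultimately obtain y s where s: "strict_mono s" "((\<lambda>n. a (r n) x) \<circ> s) \<longlonglongrightarrow> y"
    unfolding seq_compact_def by metis
  have "(\<lambda>n. a ((r \<circ> s) n) i) \<longlonglongrightarrow> (l(x := y)) i" if "i \<in> insert x S" for i
  proof (cases "i = x")
    case True
    then show ?thesis using s(2) by (simp add: o_def)
  next
    case False
    then have "(\<lambda>n. a (r n) i) \<longlonglongrightarrow> l i" using that r(2) by auto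
    from LIMSEQ_subseq_LIMSEQ[OF this s(1)] show ?thesis using False by (simp add: o_def)
  qed
  then show ?case using strict_mono_o[OF r(1) s(1)] by blast
qed

lemma is_stationary_exists:
  assumes mc: "markov_chain S P"
  shows "\<exists>\<phi>. is_stationary S P \<phi>"
proof -
  have fin: "finite S" and ne: "S \<noteq> {}" and nn: "\<And>i j. i \<in> S \<Longrightarrow> j \<in> S \<Longrightarrow> 0 \<le> P i j"
    and row: "\<And>i. i \<in> S \<Longrightarrow> (\<Sum>j\<in>S. P i j) = 1"
    using mc by (auto simp: markov_chain_def)
  obtain i0 where i0: "i0 \<in> S" using ne by blast
  define T where "T = (\<lambda>x j. \<Sum>i\<in>S. x i * P i j)"
  define x where "x = (\<lambda>m. (T ^^ m) (\<lambda>i. if i = i0 then 1 else 0))"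
  have x_Suc: "x (Suc m) j = (\<Sum>i\<in>S. x m i * P i j)" for m j
    by (simp add: x_def T_def)
  have x_nn: "0 \<le> x m j" if "j \<in> S" for m j
    using that
  proof (induction m arbitrary: j)
    case 0
    show ?case by (simp add: x_def)
  next
    case (Suc m)
    then show ?case by (auto simp: x_Suc intro!: sum_nonneg mult_nonneg_nonneg nn)
  qed
  have x_sum: "(\<Sum>j\<in>S. x m j) = 1" for m
  proof (induction m)
    case 0
    show ?case using fin i0 by (simp add: x_def)
  next
    case (Suc m)
    have "(\<Sum>j\<in>S. x (Suc m) j) = (\<Sum>i\<in>S. x m i * (\<Sum>j\<in>S. P i j))"
      unfolding x_Suc sum_distrib_left by (rule sum.swap)
    then show ?case using Suc row by simp
  qed
  have x_le: "x m j \<le> 1" if "j \<in> S" for m j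
    using member_le_sum[of j S "x m"] that x_nn fin x_sum by auto
  define a where "a = (\<lambda>n j. (\<Sum>m<Suc n. x m j) / real (Suc n))"
  have a01: "a n j \<in> {0..1}" if "j \<in> S" for n j
  proof -
    have "(\<Sum>m<Suc n. x m j) \<le> real (card {..<Suc n}) * 1"
      by (rule sum_bounded_above) (use that x_le in auto)
    then show ?thesis
      using that x_nn by (auto simp: a_def simp del: sum.lessThan_Suc intro!: sum_nonneg divide_nonneg_nonneg)
  qed
  have a_sum: "(\<Sum>j\<in>S. a n j) = 1" for n
  proof -
    have "(\<Sum>j\<in>S. a n j) = (\<Sum>m<Suc n. \<Sum>j\<in>S. x m j) / real (Suc n)"
      unfolding a_def sum_divide_distrib[symmetric] by (subst sum.swap) simp
    then show ?thesis unfolding x_sum by simp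
  qed
  have a_step: "(\<Sum>i\<in>S. a n i * P i j) - a n j = (x (Suc n) j - x 0 j) / real (Suc n)" for n j
  proof -
    have "(\<Sum>i\<in>S. a n i * P i j) = (\<Sum>i\<in>S. \<Sum>m<Suc n. x m i * P i j) / real (Suc n)"
      unfolding a_def sum_divide_distrib
      by (simp add: sum_distrib_right sum_divide_distrib del: sum.lessThan_Suc)
    also have "\<dots> = (\<Sum>m<Suc n. x (Suc m) j) / real (Suc n)"
      unfolding x_Suc by (subst sum.swap) simp
    finally have "(\<Sum>i\<in>S. a n i * P i j) - a n j
        = ((\<Sum>m<Suc n. x (Suc m) j) - (\<Sum>m<Suc n. x m j)) / real (Suc n)"
      by (simp only: a_def diff_divide_distrib)
    also have "(\<Sum>m<Suc n. x (Suc m) j) - (\<Sum>m<Suc n. x m j) = x (Suc n) j - x 0 j"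
      unfolding sum_subtractf[symmetric] by (rule sum_lessThan_telescope)
    finally show ?thesis .
  qed
  obtain r l where r: "strict_mono r" and l: "\<And>i. i \<in> S \<Longrightarrow> (\<lambda>n. a (r n) i) \<longlonglongrightarrow> l i"
    using finite_convergent_subsequence[of S a, OF fin a01] by blast
  have l_nn: "0 \<le> l i" if "i \<in> S" for i
    by (rule LIMSEQ_le_const[OF l[OF that]]) (use a01 that in auto)
  have "(\<lambda>n. \<Sum>i\<in>S. a (r n) i) \<longlonglongrightarrow> (\<Sum>i\<in>S. l i)"
    by (intro tendsto_sum l)
  then have l_sum: "(\<Sum>i\<in>S. l i) = 1"
    unfolding a_sum by (simp add: LIMSEQ_const_iff)
  have l_stat: "(\<Sum>i\<in>S. l i * P i j) = l j" if j: "j \<in> S" for j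
  proof -
    have lim: "(\<lambda>n. (\<Sum>i\<in>S. a (r n) i * P i j) - a (r n) j) \<longlonglongrightarrow> (\<Sum>i\<in>S. l i * P i j) - l j"
      by (intro tendsto_intros l j)
    have "(\<lambda>n. (x (Suc n) j - x 0 j) / real (Suc n)) \<longlonglongrightarrow> 0"
    proof (rule tendsto_rabs_zero_cancel,
        rule tendsto_sandwich[where f = "\<lambda>_. 0" and h = "\<lambda>n. 1 / real (Suc n)"])
      show "\<forall>\<^sub>F n in sequentially. \<bar>(x (Suc n) j - x 0 j) / real (Suc n)\<bar> \<le> 1 / real (Suc n)"
      proof (rule always_eventually, rule allI)
        fix n
        have "\<bar>x (Suc n) j - x 0 j\<bar> \<le> 1"
          using x_nn[OF j, of "Suc n"] x_nn[OF j, of 0] x_le[OF j, of "Suc n"] x_le[OF j, of 0]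
          by linarith
        then show "\<bar>(x (Suc n) j - x 0 j) / real (Suc n)\<bar> \<le> 1 / real (Suc n)"
          by (simp add: divide_right_mono)
      qed
      show "(\<lambda>n. 1 / real (Suc n)) \<longlonglongrightarrow> 0"
        using LIMSEQ_inverse_real_of_nat by (simp add: inverse_eq_divide)
    qed auto
    from LIMSEQ_subseq_LIMSEQ[OF this r]
    have "(\<lambda>n. (\<Sum>i\<in>S. a (r n) i * P i j) - a (r n) j) \<longlonglongrightarrow> 0"
      unfolding a_step by (simp add: o_def)
    from LIMSEQ_unique[OF lim this] show ?thesis by simp
  qed
  have "is_stationary S P (\<lambda>i. if i \<in> S then l i else 0)"
    using l_nn l_sum l_stat by (auto simp: is_stationary_def)
  then show ?thesis by blast
qed

lemma invariant_step_prob: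
  assumes "finite S" "\<And>j. j \<in> S \<Longrightarrow> (\<Sum>i\<in>S. y i * P i j) = y j" "j \<in> S"
  shows "(\<Sum>i\<in>S. y i * step_prob S P m i j) = y j"
proof (induction m)
  case 0
  show ?case using assms(1,3) by (simp add: if_distrib[where f = "\<lambda>z. _ * z"] cong: if_cong)
next
  case (Suc m)
  have "(\<Sum>i\<in>S. y i * step_prob S P (Suc m) i j)
      = (\<Sum>k\<in>S. (\<Sum>i\<in>S. y i * P i k) * step_prob S P m k j)"
    by (simp add: sum_distrib_left sum_distrib_right mult.assoc) (rule sum.swap)
  also have "\<dots> = (\<Sum>k\<in>S. y k * step_prob S P m k j)"
    using assms(2) by simp
  finally show ?case using Suc by simp
qed

lemma invariant_pos:
  assumes mc: "markov_chain S P" and irr: "irreducible_chain S P"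
    and y: "\<And>j. j \<in> S \<Longrightarrow> (\<Sum>i\<in>S. y i * P i j) = y j" "\<And>i. i \<in> S \<Longrightarrow> 0 \<le> y i"
    and i: "i \<in> S" "0 < y i" and j: "j \<in> S"
  shows "0 < y j"
proof -
  have fin: "finite S" and nn: "\<And>i j. i \<in> S \<Longrightarrow> j \<in> S \<Longrightarrow> 0 \<le> P i j"
    using mc by (auto simp: markov_chain_def)
  have sp: "0 \<le> step_prob S P m k l" if "k \<in> S" for m k l
    using that by (induction m arbitrary: k) (auto intro!: sum_nonneg mult_nonneg_nonneg nn)
  obtain m where "0 < step_prob S P m i j"
    using irr i(1) j by (auto simp: irreducible_chain_def)
  then have "0 < (\<Sum>k\<in>S. y k * step_prob S P m k j)"
    using fin i y(2) sp by (intro sum_pos2[of _ i]) auto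
  then show ?thesis using invariant_step_prob[of S y P j m] fin y(1) j by simp
qed

lemma is_stationary_unique:
  assumes mc: "markov_chain S P" and irr: "irreducible_chain S P"
    and st: "is_stationary S P \<phi>" "is_stationary S P \<psi>"
  shows "\<phi> = \<psi>"
proof -
  have fin: "finite S" and nn: "\<And>i j. i \<in> S \<Longrightarrow> j \<in> S \<Longrightarrow> 0 \<le> P i j"
    and row: "\<And>i. i \<in> S \<Longrightarrow> (\<Sum>j\<in>S. P i j) = 1"
    using mc by (auto simp: markov_chain_def)
  define y where "y = (\<lambda>i. \<phi> i - \<psi> i)"
  have y_inv: "(\<Sum>i\<in>S. y i * P i j) = y j" if "j \<in> S" for j
    using st that by (simp add: y_def is_stationary_def left_diff_distrib sum_subtractf)
  have y_sum: "(\<Sum>i\<in>S. y i) = 0"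
    using st by (simp add: y_def is_stationary_def sum_subtractf)
  have le: "\<bar>y j\<bar> \<le> (\<Sum>i\<in>S. \<bar>y i\<bar> * P i j)" if j: "j \<in> S" for j
  proof -
    have "\<bar>\<Sum>i\<in>S. y i * P i j\<bar> \<le> (\<Sum>i\<in>S. \<bar>y i * P i j\<bar>)" by (rule sum_abs)
    also have "\<dots> = (\<Sum>i\<in>S. \<bar>y i\<bar> * P i j)"
      by (rule sum.cong) (use nn j in \<open>auto simp: abs_mult\<close>)
    finally show ?thesis using y_inv[OF j] by simp
  qed
  have "(\<Sum>j\<in>S. \<Sum>i\<in>S. \<bar>y i\<bar> * P i j) = (\<Sum>i\<in>S. \<bar>y i\<bar> * (\<Sum>j\<in>S. P i j))"
    unfolding sum_distrib_left by (rule sum.swap)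
  then have "(\<Sum>j\<in>S. (\<Sum>i\<in>S. \<bar>y i\<bar> * P i j) - \<bar>y j\<bar>) = 0"
    using row by (simp add: sum_subtractf)
  then have abs_inv: "(\<Sum>i\<in>S. \<bar>y i\<bar> * P i j) = \<bar>y j\<bar>" if "j \<in> S" for j
    using sum_nonneg_eq_0_iff[of S "\<lambda>j. (\<Sum>i\<in>S. \<bar>y i\<bar> * P i j) - \<bar>y j\<bar>"] fin le that by auto
  define z where "z = (\<lambda>i. \<bar>y i\<bar> + y i)"
  have z_inv: "(\<Sum>i\<in>S. z i * P i j) = z j" if "j \<in> S" for j
    using y_inv[OF that] abs_inv[OF that] by (simp add: z_def distrib_right sum.distrib)
  have "\<not> 0 < y i" if i: "i \<in> S" for i
  proof
    assume "0 < y i"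
    then have "0 < z i" by (simp add: z_def)
    then have "0 < z j" if "j \<in> S" for j
      using invariant_pos[OF mc irr z_inv _ i _ that] by (auto simp: z_def)
    then have "0 < y j" if "j \<in> S" for j
      using that by (fastforce simp: z_def abs_if split: if_splits)
    then have "0 < (\<Sum>i\<in>S. y i)" using fin i by (intro sum_pos) auto
    then show False using y_sum by simp
  qed
  then have "y i = 0" if "i \<in> S" for i
    using sum_nonneg_eq_0_iff[of S "\<lambda>i. - y i"] fin y_sum that
    by (auto simp: sum_negf not_less)
  moreover have "y i = 0" if "i \<notin> S" for i
    using st that by (simp add: y_def is_stationary_def)
  ultimately have "y i = 0" for i by blast
  then show ?thesis by (simp add: y_def fun_eq_iff)
qed

lemma stationary_distribution_is_stationary:
  assumes "markov_chain S P" "irreducible_chain S P"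
  shows "is_stationary S P (stationary_distribution S P)"
proof -
  obtain \<phi> where \<phi>: "is_stationary S P \<phi>"
    using is_stationary_exists[OF assms(1)] by blast
  have "stationary_distribution S P = \<phi>"
    unfolding stationary_distribution_def
    by (rule the_equality) (use \<phi> is_stationary_unique[OF assms] in blast)+
  then show ?thesis using \<phi> by simp
qed

end

theory Submission
  imports Defs "HOL-Real_Asymp.Real_Asymp"
begin

text \<open>
  Let \<open>A\<close> be the adjacency matrix, \<open>J\<close> the all-ones matrix, \<open>u\<close> the uniform distribution and \<open>d = n p\<close>.
  Fix \<open>m\<close> with \<open>k m \<ge> 2\<close>, so that \<open>n / d\<^sup>m \<rightarrow> 0\<close>. Since \<open>\<phi> = \<phi> P\<^sup>m\<close>, we have
  \<open>\<phi> - u = \<phi> (P\<^sup>m - J / n)\<close>, so it suffices that the Frobenius norm of \<open>P\<^sup>m - J / n\<close> tends to \<open>0\<close>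
  in probability. By a Chernoff bound all out-degrees are \<open>(1 + o(1)) d\<close>, and \<open>P\<^sup>m\<close> may be replaced
  by \<open>(A / d)\<^sup>m\<close>. The expected square of the Frobenius norm of \<open>(A / d)\<^sup>m - J / n\<close> is then a count of walks:
  pairs of walks of length \<open>m\<close> with common ends that use \<open>E\<close> arcs and \<open>V\<close> vertices number \<open>O(n\<^sup>V)\<close>
  and contribute \<open>p\<^sup>E\<close> each. Pairs with \<open>E = 2 m\<close> give the main term \<open>d\<^sup>2\<^sup>m\<close>. Otherwise either \<open>V \<le> E\<close>,
  which gains a factor \<open>1 / d\<close>, or the union is a tree; then the walks coincide, so \<open>E \<le> m\<close>, which gains
  a factor \<open>n / d\<^sup>m\<close>.
\<close>

subsection \<open>Stationary distributions and step probabilities\<close>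

lemma step_prob_scale: "step_prob S (\<lambda>i j. c * K i j) m i j = c ^ m * step_prob S K m i j"
  by (induction m arbitrary: i) (simp_all add: sum_distrib_left mult_ac)

lemma step_prob_nonneg:
  assumes "\<And>i j. i \<in> S \<Longrightarrow> j \<in> S \<Longrightarrow> 0 \<le> K i j" "i \<in> S"
  shows "0 \<le> step_prob S K m i j"
  using assms(2) by (induction m arbitrary: i) (auto intro!: sum_nonneg mult_nonneg_nonneg assms(1))

lemma step_prob_mono:
  assumes "\<And>i j. i \<in> S \<Longrightarrow> j \<in> S \<Longrightarrow> 0 \<le> K i j"
    and "\<And>i j. i \<in> S \<Longrightarrow> j \<in> S \<Longrightarrow> K i j \<le> K' i j" and "i \<in> S"
  shows "step_prob S K m i j \<le> step_prob S K' m i j"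
  using assms(3)
proof (induction m arbitrary: i)
  case (Suc m)
  have "0 \<le> K' i k" if "i \<in> S" "k \<in> S" for i k
    using assms(1,2)[OF that] by linarith
  then show ?case
    using Suc assms step_prob_nonneg[of S K] by (auto intro!: sum_mono mult_mono)
qed auto

text \<open>Cauchy-Schwarz, applied to each entry of \<phi> - u = \<phi> (P^m - J / n), bounds the
  squared distance \<open>?z\<close> by \<open>F\<close> times the sum of the squares of \<phi>,
  which is \<open>?z + 1 / n\<close> because \<phi> sums to 1. Hence
  \<open>n * ?z \<le> (n * ?z) * F + F\<close>, and \<open>F \<le> 1 / 2\<close> lets the first
  summand be absorbed. The left-hand side is the squared chi-squared norm with respect to u.\<close>

lemma stationary_dist_uniform_le:
  assumes fin: "finite S" and S: "card S = n" and n: "n > 0" and st: "is_stationary S P \<phi>"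
    and F: "F = (\<Sum>i\<in>S. \<Sum>j\<in>S. (step_prob S P m i j - 1 / real n)\<^sup>2)" "F \<le> 1 / 2"
  shows "real n * (\<Sum>i\<in>S. (\<phi> i - 1 / real n)\<^sup>2) \<le> 2 * F"
proof -
  let ?q = "step_prob S P m" and ?z = "\<Sum>i\<in>S. (\<phi> i - 1 / real n)\<^sup>2"
  have s1: "(\<Sum>i\<in>S. \<phi> i) = 1"
    and inv: "\<And>j. j \<in> S \<Longrightarrow> (\<Sum>i\<in>S. \<phi> i * P i j) = \<phi> j"
    using st by (auto simp: is_stationary_def)
  have eq: "\<phi> j - 1 / n = (\<Sum>i\<in>S. \<phi> i * (?q i j - 1 / n))" if "j \<in> S" for j
    using invariant_step_prob[OF fin inv that, of m] s1
    by (simp add: right_diff_distrib sum_subtractf sum_divide_distrib[symmetric])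
  have phi2: "(\<Sum>i\<in>S. (\<phi> i)\<^sup>2) = ?z + 1 / n"
  proof -
    have "?z = (\<Sum>i\<in>S. (\<phi> i)\<^sup>2 - 2 / n * \<phi> i + (1 / n)\<^sup>2)"
      by (rule sum.cong) (auto simp: power2_diff)
    also have "\<dots> = (\<Sum>i\<in>S. (\<phi> i)\<^sup>2) - 2 / n * (\<Sum>i\<in>S. \<phi> i) + n * (1 / n)\<^sup>2"
      by (simp add: sum.distrib sum_subtractf sum_distrib_left S)
    also have "real n * (1 / n)\<^sup>2 = 1 / n"
      using n by (simp add: power2_eq_square)
    finally show ?thesis using s1 by simp
  qed
  have "?z \<le> (\<Sum>j\<in>S. (\<Sum>i\<in>S. (\<phi> i)\<^sup>2) * (\<Sum>i\<in>S. (?q i j - 1 / n)\<^sup>2))"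
    by (rule sum_mono) (simp only: eq Cauchy_Schwarz_ineq_sum)
  also have "\<dots> = (?z + 1 / n) * F"
    unfolding phi2 F(1) sum_distrib_left[symmetric] by (subst sum.swap) simp
  finally have "real n * ?z \<le> real n * ((?z + 1 / n) * F)"
    by (rule mult_left_mono) simp
  also have "\<dots> = (real n * ?z) * F + F"
    using n by (simp add: field_simps)
  finally have *: "real n * ?z \<le> (real n * ?z) * F + F" .
  have "(real n * ?z) * F \<le> (real n * ?z) * (1 / 2)"
    by (rule mult_left_mono) (use F(2) in \<open>auto intro!: mult_nonneg_nonneg sum_nonneg\<close>)
  with * show ?thesis by simp
qed

text \<open>Two uses of (x + y)^2 \<le> 2 x^2 + 2 y^2: one splits \<open>q - 1 / n\<close> at
  \<open>b\<close>, the other splits \<open>b\<close> at \<open>1 / n\<close>. The summand 1 is the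
  squared Frobenius norm of J / n.\<close>

lemma frobenius_dist_perturb:
  fixes q b :: "'a \<Rightarrow> 'a \<Rightarrow> real"
  assumes S: "card S = n" and n: "n > 0"
    and qb: "\<And>i j. i \<in> S \<Longrightarrow> j \<in> S \<Longrightarrow> \<bar>q i j - b i j\<bar> \<le> \<kappa> * b i j"
    and G: "G = (\<Sum>i\<in>S. \<Sum>j\<in>S. (b i j - 1 / real n)\<^sup>2)"
  shows "(\<Sum>i\<in>S. \<Sum>j\<in>S. (q i j - 1 / real n)\<^sup>2) \<le> 2 * G + 4 * \<kappa>\<^sup>2 * (G + 1)"
proof -
  have sq: "(x + y)\<^sup>2 \<le> 2 * x\<^sup>2 + 2 * y\<^sup>2" for x y :: real
    using sum_squares_bound[of x y] by (simp add: power2_sum)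
  have "(q i j - 1 / n)\<^sup>2 \<le> 2 * (b i j - 1 / n)\<^sup>2 + 4 * \<kappa>\<^sup>2 * ((b i j - 1 / n)\<^sup>2 + (1 / n)\<^sup>2)"
    if "i \<in> S" "j \<in> S" for i j
  proof -
    have "(q i j - b i j)\<^sup>2 \<le> (\<kappa> * b i j)\<^sup>2"
      using qb[OF that] abs_le_square_iff abs_ge_self order_trans by blast
    moreover have "(b i j)\<^sup>2 \<le> 2 * (b i j - 1 / n)\<^sup>2 + 2 * (1 / n)\<^sup>2"
      using sq[of "b i j - 1 / n" "1 / n"] by simp
    then have "\<kappa>\<^sup>2 * (b i j)\<^sup>2 \<le> \<kappa>\<^sup>2 * (2 * (b i j - 1 / n)\<^sup>2 + 2 * (1 / n)\<^sup>2)"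
      by (rule mult_left_mono) simp
    moreover have "(q i j - 1 / n)\<^sup>2 \<le> 2 * (b i j - 1 / n)\<^sup>2 + 2 * (q i j - b i j)\<^sup>2"
      using sq[of "b i j - 1 / n" "q i j - b i j"] by simp
    ultimately show ?thesis by (simp add: power_mult_distrib algebra_simps)
  qed
  then have "(\<Sum>i\<in>S. \<Sum>j\<in>S. (q i j - 1 / real n)\<^sup>2) \<le>
    (\<Sum>i\<in>S. \<Sum>j\<in>S. 2 * (b i j - 1 / n)\<^sup>2 + 4 * \<kappa>\<^sup>2 * ((b i j - 1 / n)\<^sup>2 + (1 / n)\<^sup>2))"
    by (intro sum_mono) auto
  also have "\<dots> = 2 * G + 4 * \<kappa>\<^sup>2 * (G + (\<Sum>i\<in>S. \<Sum>j\<in>S. (1 / n)\<^sup>2))"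
    unfolding G by (simp only: sum.distrib sum_distrib_left[symmetric])
  also have "(\<Sum>i\<in>S. \<Sum>j\<in>S. (1 / real n)\<^sup>2) = 1"
    using n S by (simp add: power2_eq_square)
  finally show ?thesis .
qed

definition adj :: "('a \<times> 'a) set \<Rightarrow> 'a \<Rightarrow> 'a \<Rightarrow> real" where
  "adj E i j = of_bool ((i, j) \<in> E)"

text \<open>\<open>P\<close> lies entrywise between \<open>adj E\<close> divided by
  \<open>(1 + \<eta>) * d\<close> and by \<open>(1 - \<eta>) * d\<close>. Step probabilities are
  monotone in the kernel and homogeneous of degree \<open>m\<close>, so the bounds pass to the
  \<open>m\<close>-step kernel.\<close>

lemma step_prob_walk_approx:
  assumes d: "d > 0" and \<eta>: "0 \<le> \<eta>" "\<eta> < 1"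
    and D: "\<And>i. i \<in> S \<Longrightarrow> (1 - \<eta>) * d \<le> D i \<and> D i \<le> (1 + \<eta>) * d"
    and P: "\<And>i j. i \<in> S \<Longrightarrow> j \<in> S \<Longrightarrow> P i j = adj E i j / D i"
    and i: "i \<in> S"
  shows "\<bar>step_prob S P m i j - step_prob S (adj E) m i j / d ^ m\<bar>
    \<le> ((1 / (1 - \<eta>)) ^ m - (1 / (1 + \<eta>)) ^ m) * (step_prob S (adj E) m i j / d ^ m)"
proof -
  let ?b = "step_prob S (adj E) m i j / d ^ m"
  have b0: "0 \<le> ?b"
    using d i by (auto intro!: divide_nonneg_nonneg step_prob_nonneg simp: adj_def)
  have pos: "0 < (1 - \<eta>) * d" using d \<eta> by simp
  have lo: "1 / ((1 + \<eta>) * d) * adj E i j \<le> P i j"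
    and hi: "P i j \<le> 1 / ((1 - \<eta>) * d) * adj E i j" if "i \<in> S" "j \<in> S" for i j
    using P[OF that] D[OF that(1)] pos d \<eta> less_le_trans[OF pos]
    by (auto simp: adj_def intro!: divide_left_mono mult_pos_pos)
  have "step_prob S (\<lambda>i j. 1 / ((1 + \<eta>) * d) * adj E i j) m i j \<le> step_prob S P m i j"
    by (rule step_prob_mono[OF _ lo]) (use d \<eta> i in \<open>auto simp: adj_def\<close>)
  then have lo': "(1 / (1 + \<eta>)) ^ m * ?b \<le> step_prob S P m i j"
    unfolding step_prob_scale by (simp add: power_mult_distrib power_divide)
  have "0 \<le> P i j" if "i \<in> S" "j \<in> S" for i j
    using P[OF that] D[OF that(1)] pos by (auto simp: adj_def)
  then have "step_prob S P m i j \<le> step_prob S (\<lambda>i j. 1 / ((1 - \<eta>) * d) * adj E i j) m i j"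
    by (rule step_prob_mono[OF _ hi]) (use i in auto)
  then have hi': "step_prob S P m i j \<le> (1 / (1 - \<eta>)) ^ m * ?b"
    unfolding step_prob_scale by (simp add: power_mult_distrib power_divide)
  \<comment> \<open>The two factors enclose 1, so \<open>?b\<close> itself lies in the same interval
    and the deviation is at most its width.\<close>
  have "(1 / (1 + \<eta>)) ^ m * ?b \<le> 1 * ?b" "1 * ?b \<le> (1 / (1 - \<eta>)) ^ m * ?b"
    using \<eta> by (intro mult_right_mono[OF _ b0] power_le_one one_le_power; simp)+
  with lo' hi' show ?thesis unfolding left_diff_distrib abs_le_iff by linarith
qed

subsection \<open>Counting walks\<close>

definition lists_len :: "'a set \<Rightarrow> nat \<Rightarrow> 'a list set" where
  "lists_len S m = {xs. set xs \<subseteq> S \<and> length xs = m}"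

lemma lists_len_0 [simp]: "lists_len S 0 = {[]}"
  by (auto simp: lists_len_def)

lemma finite_lists_len [simp]: "finite S \<Longrightarrow> finite (lists_len S m)"
  unfolding lists_len_def by (rule finite_lists_length_eq)

lemma card_lists_len: "finite S \<Longrightarrow> card (lists_len S m) = card S ^ m"
  unfolding lists_len_def by (rule card_lists_length_eq)

lemma sum_lists_len_Suc:
  fixes f :: "'a list \<Rightarrow> real"
  shows "(\<Sum>xs\<in>lists_len S (Suc m). f xs) = (\<Sum>x\<in>S. \<Sum>xs\<in>lists_len S m. f (x # xs))"
proof -
  have "(\<Sum>xs\<in>lists_len S (Suc m). f xs) = (\<Sum>(xs, x)\<in>lists_len S m \<times> S. f (x # xs))"
    unfolding lists_len_def lists_length_Suc_eq
    by (subst sum.reindex) (auto simp: inj_on_def case_prod_unfold)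
  also have "\<dots> = (\<Sum>xs\<in>lists_len S m. \<Sum>x\<in>S. f (x # xs))"
    by (simp add: sum.cartesian_product)
  also have "\<dots> = (\<Sum>x\<in>S. \<Sum>xs\<in>lists_len S m. f (x # xs))"
    by (rule sum.swap)
  finally show ?thesis .
qed

text \<open>Prescribing the end of a walk costs one free vertex. This is where the common end of a
  pair of walks saves a factor \<open>n\<close>.\<close>

lemma sum_lists_len_last:
  fixes f :: "'a list \<Rightarrow> real"
  assumes "finite S" "v \<in> S"
  shows "(\<Sum>ys\<in>lists_len S (Suc m). of_bool (last ys = v) * f ys)
    = (\<Sum>zs\<in>lists_len S m. f (zs @ [v]))"
proof -
  have "(\<Sum>ys\<in>lists_len S (Suc m). of_bool (last ys = v) * f ys)
      = (\<Sum>ys\<in>(\<lambda>zs. zs @ [v]) ` lists_len S m. of_bool (last ys = v) * f ys)"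
  proof (rule sum.mono_neutral_right)
    show "(\<lambda>zs. zs @ [v]) ` lists_len S m \<subseteq> lists_len S (Suc m)"
      using assms(2) by (auto simp: lists_len_def)
    show "\<forall>ys\<in>lists_len S (Suc m) - (\<lambda>zs. zs @ [v]) ` lists_len S m.
        of_bool (last ys = v) * f ys = 0"
    proof
      fix ys assume "ys \<in> lists_len S (Suc m) - (\<lambda>zs. zs @ [v]) ` lists_len S m"
      moreover have "ys \<in> (\<lambda>zs. zs @ [v]) ` lists_len S m"
        if ys: "ys \<in> lists_len S (Suc m)" "last ys = v"
      proof (rule image_eqI)
        have "ys \<noteq> []" using ys(1) by (auto simp: lists_len_def)
        then show "ys = butlast ys @ [v]" unfolding ys(2)[symmetric] by simp
        show "butlast ys \<in> lists_len S m"
          using ys(1) in_set_butlastD[of _ ys] by (auto simp: lists_len_def)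
      qed
      ultimately show "of_bool (last ys = v) * f ys = 0" by auto
    qed
  qed (use assms in auto)
  also have "\<dots> = (\<Sum>zs\<in>lists_len S m. f (zs @ [v]))"
    by (subst sum.reindex) (auto simp: inj_on_def)
  finally show ?thesis .
qed

text \<open>A walk is given by its start \<open>i\<close> and the list of its later vertices. Its
  arcs form a set because an arc traversed repeatedly must be present only once, so that the walk
  exists with probability \<open>p\<close> to the number of distinct arcs.\<close>

primrec walk_arcs :: "'a \<Rightarrow> 'a list \<Rightarrow> ('a \<times> 'a) set" where
  "walk_arcs i [] = {}"
| "walk_arcs i (x # xs) = insert (i, x) (walk_arcs x xs)"

lemma walk_arcs_append: "walk_arcs i (xs @ ys) = walk_arcs i xs \<union> walk_arcs (last (i # xs)) ys"
  by (induction xs arbitrary: i) auto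

lemma finite_walk_arcs [simp]: "finite (walk_arcs i xs)"
  by (induction xs arbitrary: i) auto

lemma card_walk_arcs_le: "card (walk_arcs i xs) \<le> length xs"
proof (induction xs arbitrary: i)
  case (Cons x xs)
  have "card (walk_arcs i (x # xs)) \<le> Suc (card (walk_arcs x xs))"
    by (simp add: card_insert_if)
  then show ?case using Cons.IH[of x] by simp
qed simp

lemma walk_arcs_subset: "walk_arcs i xs \<subseteq> set (i # xs) \<times> set xs"
proof (induction xs arbitrary: i)
  case (Cons x xs)
  then have "walk_arcs x xs \<subseteq> set (x # xs) \<times> set xs" .
  also have "\<dots> \<subseteq> set (i # x # xs) \<times> set (x # xs)"
    by (intro Sigma_mono) auto
  finally show ?case by simp
qed simp

lemma walk_arcs_distinct:
  assumes "distinct (i # xs)"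
  shows "card (walk_arcs i xs) = length xs" "\<forall>(u, v)\<in>walk_arcs i xs. u \<noteq> v"
proof -
  have "card (walk_arcs i xs) = length xs \<and> (\<forall>(u, v)\<in>walk_arcs i xs. u \<noteq> v)"
    using assms
  proof (induction xs arbitrary: i)
    case (Cons x xs)
    moreover have "(i, x) \<notin> walk_arcs x xs"
      using walk_arcs_subset[of x xs] Cons.prems by auto
    ultimately show ?case by auto
  qed auto
  then show "card (walk_arcs i xs) = length xs" "\<forall>(u, v)\<in>walk_arcs i xs. u \<noteq> v" by auto
qed

lemma step_prob_adj:
  assumes "finite S" "i \<in> S"
  shows "step_prob S (adj E) m i j
    = (\<Sum>xs\<in>lists_len S m. of_bool (last (i # xs) = j) * of_bool (walk_arcs i xs \<subseteq> E))"
  using assms(2)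
proof (induction m arbitrary: i)
  case (Suc m)
  have "step_prob S (adj E) (Suc m) i j = (\<Sum>k\<in>S. adj E i k *
      (\<Sum>xs\<in>lists_len S m. of_bool (last (k # xs) = j) * of_bool (walk_arcs k xs \<subseteq> E)))"
    using Suc by simp
  then show ?case
    unfolding sum_lists_len_Suc sum_distrib_left
    by (elim trans, intro sum.cong refl) (simp add: adj_def)
qed auto

text \<open>Explore a walk from a vertex of the connected structure \<open>(U, F)\<close>. As long as the exploration
  creates no cycle, every new arc ends in a new vertex, so once the walk has left \<open>(U, F)\<close> it is
  stuck in vertices outside \<open>U\<close>.\<close>

lemma walk_extension:
  assumes "finite U" "finite F" "F \<subseteq> U \<times> U" "i \<in> U" "card U \<le> Suc (card F)"
  shows "card (U \<union> set ys) \<le> Suc (card (F \<union> walk_arcs i ys)) \<and>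
    (walk_arcs i ys \<subseteq> F \<or> card (U \<union> set ys) \<le> card (F \<union> walk_arcs i ys) \<or>
     last (i # ys) \<notin> U \<and> last (i # ys) \<notin> fst ` (F \<union> walk_arcs i ys))"
proof (induction ys rule: rev_induct)
  case Nil
  then show ?case using assms by simp
next
  case (snoc v ys)
  define l V E where defs: "l = last (i # ys)" "V = U \<union> set ys" "E = F \<union> walk_arcs i ys"
  have fin: "finite V" "finite E" using assms by (auto simp: defs)
  have sub: "E \<subseteq> V \<times> V" using assms(3,4) walk_arcs_subset[of i ys] by (auto simp: defs)
  have "l \<in> insert i (set ys)" unfolding defs by (metis last_in_set list.distinct(1) list.simps(15))
  then have l: "l \<in> V" using assms(4) by (auto simp: defs)
  have wa: "walk_arcs i (ys @ [v]) = insert (l, v) (walk_arcs i ys)"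
    by (simp add: walk_arcs_append defs)
  have eqs: "U \<union> set (ys @ [v]) = insert v V" "F \<union> walk_arcs i (ys @ [v]) = insert (l, v) E"
    "last (i # ys @ [v]) = v"
    by (auto simp: defs wa)
  have IH: "card V \<le> Suc (card E)" "walk_arcs i ys \<subseteq> F \<or> card V \<le> card E \<or> l \<notin> U \<and> l \<notin> fst ` E"
    using snoc by (auto simp: defs)
  \<comment> \<open>An old arc changes nothing, and it rules out that \<open>l\<close> starts no arc
    of \<open>E\<close>. A new arc to an old vertex raises only the arc count, which gives
    \<open>card V \<le> card E\<close>. A new arc to a new vertex raises both counts, and that
    vertex starts no arc yet.\<close>
  consider "(l, v) \<in> E" | "(l, v) \<notin> E" "v \<in> V" | "(l, v) \<notin> E" "v \<notin> V" by blast
  then show ?case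
  proof cases
    case 1
    then have "v \<in> V" using sub by auto
    moreover have "walk_arcs i ys \<subseteq> F \<or> card V \<le> card E" using IH(2) 1 by force
    ultimately show ?thesis using 1 IH unfolding eqs wa
      by (auto simp: insert_absorb defs(3))
  next
    case 2
    then show ?thesis using IH fin unfolding eqs by (simp add: insert_absorb)
  next
    case 3
    have "v \<notin> U" "v \<notin> fst ` insert (l, v) E" using 3 l sub by (auto simp: defs(2))
    then show ?thesis using IH fin 3 unfolding eqs by simp
  qed
qed

text \<open>In the last case both walks traverse the same arcs.\<close>

lemma walk_pair_card:
  assumes "last (i # xs) = last (i # ys)" "length xs = m" "length ys = m"
  defines "V \<equiv> card (set (i # xs @ ys))" and "E \<equiv> card (walk_arcs i xs \<union> walk_arcs i ys)"
  shows "E = 2 * m \<or> E < 2 * m \<and> V \<le> E \<or> E \<le> m \<and> V \<le> Suc E"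
proof -
  have xs: "card (set (i # xs)) \<le> Suc (card (walk_arcs i xs))"
    using walk_extension[of "{i}" "{}" i xs] by simp
  have last: "last (i # ys) \<in> set (i # xs)"
    unfolding assms(1)[symmetric] by (rule last_in_set) simp
  have sub: "walk_arcs i xs \<subseteq> set (i # xs) \<times> set (i # xs)"
    using walk_arcs_subset[of i xs] by auto
  have set_eq: "set (i # xs) \<union> set ys = set (i # xs @ ys)" by auto
  \<comment> \<open>The second exploration starts from the structure left by the first. As
    \<open>ys\<close> ends where \<open>xs\<close> ends, inside \<open>set (i # xs)\<close>, the
    last alternative of \<open>walk_extension\<close> is excluded.\<close>
  have "card (set (i # xs) \<union> set ys) \<le> Suc E \<and>
      (walk_arcs i ys \<subseteq> walk_arcs i xs \<or> card (set (i # xs) \<union> set ys) \<le> E)"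
    using walk_extension[of "set (i # xs)" "walk_arcs i xs" i ys] xs sub last
    unfolding E_def by (metis List.finite_set finite_walk_arcs list.set_intros(1))
  then have 1: "V \<le> Suc E" "walk_arcs i ys \<subseteq> walk_arcs i xs \<or> V \<le> E"
    unfolding set_eq V_def by auto
  have "E \<le> card (walk_arcs i xs) + card (walk_arcs i ys)"
    unfolding E_def by (rule card_Un_le)
  then have 2: "E \<le> 2 * m"
    using card_walk_arcs_le[of i xs] card_walk_arcs_le[of i ys] assms(2,3) by linarith
  show ?thesis
  proof (cases "walk_arcs i ys \<subseteq> walk_arcs i xs")
    case True
    then have "E = card (walk_arcs i xs)" by (simp add: E_def sup.absorb1)
    then show ?thesis using 1 card_walk_arcs_le[of i xs] assms(2) by simp
  next
    case False
    then show ?thesis using 1 2 by linarith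
  qed
qed

section \<open>Weighted counts of walks and pairs of walks\<close>

text \<open>Each further entry is either an already visited vertex, with fewer than
  \<open>card U + m\<close> choices, or a new one, where at most \<open>n\<close> choices meet an
  extra weight \<open>1 / n\<close>. So each of the \<open>m\<close> entries costs a factor of at
  most \<open>card U + m\<close>.\<close>

lemma sum_lists_vertex_weight:
  assumes S: "finite S" "card S = n" "n > 0" and U: "finite U"
  shows "(\<Sum>zs\<in>lists_len S m. 1 / real n ^ card (U \<union> set zs))
    \<le> real (card U + m) ^ m / real n ^ card U"
  using U
proof (induction m arbitrary: U)
  case (Suc m)
  let ?c = "real (card U + Suc m)"
  \<comment> \<open>The two summands on the right bound the cases of an old and of a new first entry
    \<open>x\<close>.\<close>
  have "(\<Sum>zs\<in>lists_len S m. 1 / real n ^ card (U \<union> set (x # zs)))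
      \<le> ?c ^ m * (of_bool (x \<in> U) / real n ^ card U + 1 / real n ^ Suc (card U))" (is "?l x \<le> ?r x")
    for x
  proof -
    have "?l x \<le> real (card (insert x U) + m) ^ m / real n ^ card (insert x U)"
      using Suc.IH[of "insert x U"] Suc.prems by simp
    also have "\<dots> \<le> ?c ^ m / real n ^ card (insert x U)"
      using Suc.prems by (intro divide_right_mono power_mono) (auto simp: card_insert_if)
    also have "\<dots> = ?c ^ m * (1 / real n ^ card (insert x U))"
      by simp
    also have "\<dots> \<le> ?r x"
      using Suc.prems by (intro mult_left_mono) (auto simp: card_insert_if)
    finally show ?thesis .
  qed
  then have "(\<Sum>zs\<in>lists_len S (Suc m). 1 / real n ^ card (U \<union> set zs)) \<le> (\<Sum>x\<in>S. ?r x)"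
    unfolding sum_lists_len_Suc by (rule sum_mono)
  also have "\<dots> = ?c ^ m * ((\<Sum>x\<in>S. of_bool (x \<in> U)) / real n ^ card U + 1 / real n ^ card U)"
    using S(3) by (simp add: sum_distrib_left[symmetric] sum.distrib sum_divide_distrib[symmetric] S(2))
  also have "(\<Sum>x\<in>S. of_bool (x \<in> U) :: real) = card (S \<inter> U)"
    using S(1) by (simp add: Int_def)
  also have "?c ^ m * (card (S \<inter> U) / real n ^ card U + 1 / real n ^ card U)
      \<le> ?c ^ m * (?c / real n ^ card U)"
  proof (rule mult_left_mono)
    have "card (S \<inter> U) \<le> card U" using Suc.prems by (simp add: card_mono)
    then have "real (card (S \<inter> U)) + 1 \<le> ?c" by simp
    then show "card (S \<inter> U) / real n ^ card U + 1 / real n ^ card U \<le> ?c / real n ^ card U"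
      unfolding add_divide_distrib[symmetric] by (rule divide_right_mono) simp
  qed simp
  finally show ?case by (simp add: mult.commute)
qed simp

text \<open>By \<open>walk_pair_card\<close>, a pair of walks on \<open>V\<close> vertices
  contributes at most \<open>p ^ (2 * m) + c / n ^ V\<close>. There are at most
  \<open>n ^ (2 * m)\<close> pairs with a common end, which yields the main term
  \<open>d ^ (2 * m)\<close>, and \<open>sum_lists_vertex_weight\<close> sums the weights, first
  over \<open>ys\<close> and then over \<open>xs\<close>.\<close>

lemma sum_walk_pairs_le:
  assumes S: "finite S" "card S = n" "n > 0" and d: "d = real n * p" "d \<ge> 1" and m: "m > 0"
  shows "(\<Sum>i\<in>S. \<Sum>xs\<in>lists_len S m. \<Sum>ys\<in>lists_len S m.
      of_bool (last (i # xs) = last (i # ys)) * p ^ card (walk_arcs i xs \<union> walk_arcs i ys))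
    \<le> d ^ (2 * m) * (1 + real (2 * m + 1) ^ (2 * m) * (1 / d + real n / d ^ m))"
proof -
  have p: "p = d / n" using d S by simp
  have n1: "real n \<ge> 1" using S by simp
  let ?w = "\<lambda>V. 1 / real n ^ V"
  \<comment> \<open>With \<open>p ^ E = d ^ E / n ^ E\<close>, the constant \<open>c\<close> must
    dominate \<open>d ^ E\<close> when \<open>V \<le> E < 2 * m\<close>, and
    \<open>n * d ^ E\<close> when \<open>E \<le> m\<close> and \<open>V \<le> E + 1\<close>. The two
    summands do so in turn.\<close>
  define c where "c = d ^ (2 * m) * (1 / d + real n / d ^ m)"
  have c0: "c \<ge> 0" using d(2) by (simp add: c_def)
  have summand: "p ^ card (walk_arcs i xs \<union> walk_arcs i ys)
      \<le> p ^ (2 * m) + c * ?w (card (set (i # xs @ ys)))"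
    if walks: "xs \<in> lists_len S m" "ys \<in> lists_len S m" "last (i # xs) = last (i # ys)" for i xs ys
  proof -
    define E V where EV: "E = card (walk_arcs i xs \<union> walk_arcs i ys)" "V = card (set (i # xs @ ys))"
    have pE: "p ^ E = d ^ E * ?w E" by (simp add: p power_divide)
    have p0: "0 \<le> p ^ (2 * m)" using p d(2) by simp
    consider "E = 2 * m" | "E < 2 * m" "V \<le> E" | "E \<le> m" "V \<le> Suc E"
      using walk_pair_card[OF walks(3), of m] walks(1,2) unfolding EV lists_len_def by blast
    then have "p ^ E \<le> p ^ (2 * m) + c * ?w V"
    proof cases
      case 1
      then show ?thesis using c0 by simp
    next
      case 2
      have "d ^ E \<le> d ^ (2 * m - 1)" using 2 d(2) by (intro power_increasing) auto
      also have "\<dots> = d ^ (2 * m) * (1 / d)" using d(2) m by (simp add: power_diff)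
      also have "\<dots> \<le> c" unfolding c_def using d(2) by (intro mult_left_mono) auto
      finally have "d ^ E * ?w E \<le> c * ?w V"
        using 2 c0 n1 S(3) by (intro mult_mono divide_left_mono power_increasing) auto
      then show ?thesis using p0 unfolding pE by linarith
    next
      case 3
      have "d ^ E * real n \<le> d ^ m * real n" using 3 d(2) by (intro mult_right_mono power_increasing) auto
      also have "\<dots> = d ^ (2 * m) * (real n / d ^ m)"
        using d(2) by (simp add: mult_2 power_add)
      also have "\<dots> \<le> c" unfolding c_def using d(2) by (intro mult_left_mono) auto
      finally have "d ^ E * real n \<le> c" .
      moreover have "?w (Suc E) \<le> ?w V"
        using 3 n1 S(3) by (intro divide_left_mono power_increasing) auto
      ultimately have "d ^ E * real n * ?w (Suc E) \<le> c * ?w V"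
        using c0 by (intro mult_mono) auto
      moreover have "d ^ E * real n * ?w (Suc E) = p ^ E"
        using S(3) by (simp add: pE)
      ultimately show ?thesis using p0 by linarith
    qed
    then show ?thesis by (simp only: EV)
  qed
  obtain m' where m': "m = Suc m'" using m gr0_implies_Suc by blast
  have inner: "(\<Sum>ys\<in>lists_len S m.
      of_bool (last (i # xs) = last (i # ys)) * p ^ card (walk_arcs i xs \<union> walk_arcs i ys))
    \<le> real n ^ m' * p ^ (2 * m) + c * (real (2 * m + 1) ^ m * ?w (card ({i} \<union> set xs)))" (is "?L \<le> _")
    if i: "i \<in> S" and xs: "xs \<in> lists_len S m" for i xs
  proof -
    let ?v = "last (i # xs)" and ?U = "{i} \<union> set xs"
    have v: "?v \<in> S"
    proof -
      have "?v \<in> set (i # xs)" by (rule last_in_set) simp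
      then show ?thesis using i xs by (auto simp: lists_len_def)
    qed
    have vU: "?v \<in> ?U"
      by (metis Un_insert_left last_in_set list.distinct(1) list.simps(15) sup_bot_left)
    have "?L \<le> (\<Sum>ys\<in>lists_len S m.
        of_bool (last ys = ?v) * (p ^ (2 * m) + c * ?w (card (set (i # xs @ ys)))))"
    proof (rule sum_mono)
      fix ys assume ys: "ys \<in> lists_len S m"
      then have "last (i # ys) = last ys" using m by (auto simp: lists_len_def)
      then have eq: "(last ys = ?v) = (last (i # xs) = last (i # ys))" by (simp only: eq_commute)
      show "of_bool (last (i # xs) = last (i # ys)) * p ^ card (walk_arcs i xs \<union> walk_arcs i ys)
        \<le> of_bool (last ys = ?v) * (p ^ (2 * m) + c * ?w (card (set (i # xs @ ys))))"
      proof (cases "last (i # xs) = last (i # ys)")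
        case True
        show ?thesis using summand[OF xs ys True] unfolding eq by (simp only: True simp_thms of_bool_eq mult_1)
      next
        case False
        then show ?thesis unfolding eq by (simp only: simp_thms of_bool_eq mult_zero_left order_refl)
      qed
    qed
    also have "\<dots> = (\<Sum>zs\<in>lists_len S m'. p ^ (2 * m) + c * ?w (card (set (i # xs @ zs @ [?v]))))"
      unfolding m' by (rule sum_lists_len_last[OF S(1) v])
    \<comment> \<open>The prescribed end \<open>?v\<close> is a vertex of the first walk, so it adds
      nothing to the vertex set.\<close>
    also have "\<dots> = (\<Sum>zs\<in>lists_len S m'. p ^ (2 * m) + c * ?w (card (?U \<union> set zs)))"
    proof (rule sum.cong[OF refl])
      fix zs
      have "set (i # xs @ zs @ [?v]) = ?U \<union> set zs" using vU by auto
      then show "p ^ (2 * m) + c * ?w (card (set (i # xs @ zs @ [?v])))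
        = p ^ (2 * m) + c * ?w (card (?U \<union> set zs))" by (simp only:)
    qed
    also have "\<dots> = real n ^ m' * p ^ (2 * m) + c * (\<Sum>zs\<in>lists_len S m'. ?w (card (?U \<union> set zs)))"
      by (simp only: sum.distrib sum_constant card_lists_len[OF S(1)] S(2) sum_distrib_left of_nat_power)
    also have "(\<Sum>zs\<in>lists_len S m'. ?w (card (?U \<union> set zs)))
        \<le> real (card ?U + m') ^ m' / real n ^ card ?U"
      by (rule sum_lists_vertex_weight[OF S]) simp
    \<comment> \<open>Here \<open>card ?U \<le> m + 1\<close> and \<open>m' = m - 1\<close>. The
      base \<open>2 * m + 1\<close> is chosen to serve the sum over \<open>xs\<close> as
      well.\<close>
    also have "\<dots> \<le> real (2 * m + 1) ^ m / real n ^ card ?U"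
    proof (rule divide_right_mono)
      have "card ?U \<le> Suc (card (set xs))" by (simp add: card_insert_if)
      also have "card (set xs) \<le> m" using xs card_length[of xs] by (simp add: lists_len_def)
      finally have "real (card ?U + m') \<le> real (2 * m + 1)" using m' by simp
      then have "real (card ?U + m') ^ m' \<le> real (2 * m + 1) ^ m'" by (intro power_mono) auto
      also have "\<dots> \<le> real (2 * m + 1) ^ m" using m' by (intro power_increasing) auto
      finally show "real (card ?U + m') ^ m' \<le> real (2 * m + 1) ^ m" .
    qed simp
    finally show ?thesis using c0 by (simp add: mult_left_mono)
  qed
  have middle: "(\<Sum>xs\<in>lists_len S m. real n ^ m' * p ^ (2 * m)
        + c * (real (2 * m + 1) ^ m * ?w (card ({i} \<union> set xs))))
      \<le> real n ^ m * (real n ^ m' * p ^ (2 * m)) + c * (real (2 * m + 1) ^ (2 * m) * (1 / real n))" for i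
  proof -
    have "(\<Sum>xs\<in>lists_len S m. ?w (card ({i} \<union> set xs))) \<le> real (1 + m) ^ m / real n"
      using sum_lists_vertex_weight[OF S, of "{i}" m] by simp
    also have "\<dots> \<le> real (2 * m + 1) ^ m / real n"
      by (intro divide_right_mono power_mono) auto
    finally have *: "c * (real (2 * m + 1) ^ m * (\<Sum>xs\<in>lists_len S m. ?w (card ({i} \<union> set xs))))
        \<le> c * (real (2 * m + 1) ^ m * (real (2 * m + 1) ^ m / real n))"
      using c0 by (intro mult_left_mono) auto
    have split: "(\<Sum>xs\<in>lists_len S m. real n ^ m' * p ^ (2 * m)
        + c * (real (2 * m + 1) ^ m * ?w (card ({i} \<union> set xs))))
      = real n ^ m * (real n ^ m' * p ^ (2 * m))
        + c * (real (2 * m + 1) ^ m * (\<Sum>xs\<in>lists_len S m. ?w (card ({i} \<union> set xs))))"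
      by (simp only: sum.distrib sum_constant card_lists_len[OF S(1)] S(2) sum_distrib_left[symmetric] of_nat_power)
    have eq: "x ^ m * (x ^ m / y) = x ^ (2 * m) * (1 / y)" for x y :: real
      by (simp add: mult_2 power_add)
    show ?thesis unfolding split by (rule add_left_mono) (rule *[unfolded eq])
  qed
  have "(\<Sum>i\<in>S. \<Sum>xs\<in>lists_len S m. \<Sum>ys\<in>lists_len S m.
      of_bool (last (i # xs) = last (i # ys)) * p ^ card (walk_arcs i xs \<union> walk_arcs i ys))
    \<le> (\<Sum>i\<in>S. real n ^ m * (real n ^ m' * p ^ (2 * m))
          + c * (real (2 * m + 1) ^ (2 * m) * (1 / real n)))"
    by (rule sum_mono, rule order_trans[OF sum_mono middle], rule inner)
  also have "\<dots> = (real n * real n ^ m * real n ^ m') * p ^ (2 * m) + c * real (2 * m + 1) ^ (2 * m)"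
  proof -
    have "x * (a * (b * q) + c * (y * (1 / x))) = x * a * b * q + c * y" if "x \<noteq> 0" for x a b q y :: real
      using that by (simp add: field_simps)
    then show ?thesis using S(3) by (simp only: sum_constant S(2))
  qed
  also have "real n * real n ^ m * real n ^ m' = real n ^ (2 * m)"
    by (simp add: m' mult_2 power_add)
  also have "real n ^ (2 * m) * p ^ (2 * m) = d ^ (2 * m)"
    by (simp add: d power_mult_distrib)
  also have "d ^ (2 * m) + c * y = d ^ (2 * m) * (1 + y * (1 / d + real n / d ^ m))" for y
    unfolding c_def by (simp only: distrib_left mult_1_right mult_ac)
  finally show ?thesis .
qed

text \<open>The number of such walks is the falling factorial n (n - 1) ... (n - m), whose
  \<open>m + 1\<close> factors are all at least \<open>n - m\<close>.\<close>

lemma sum_distinct_walks_ge: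
  assumes S: "finite S" "card S = n" and m: "m < n"
  shows "(\<Sum>i\<in>S. \<Sum>xs\<in>lists_len S m. of_bool (distinct (i # xs))) \<ge> (real n - real m) ^ Suc m"
proof -
  let ?D = "{xs. length xs = Suc m \<and> distinct xs \<and> set xs \<subseteq> S}"
  have "(\<Sum>i\<in>S. \<Sum>xs\<in>lists_len S m. of_bool (distinct (i # xs)))
      = (\<Sum>xs\<in>lists_len S (Suc m). of_bool (distinct xs) :: real)"
    by (rule sum_lists_len_Suc[symmetric])
  also have "\<dots> = real (card {xs \<in> lists_len S (Suc m). distinct xs})"
    using S(1) by (simp add: Int_def)
  also have "{xs \<in> lists_len S (Suc m). distinct xs} = ?D"
    by (auto simp: lists_len_def)
  also have "card ?D = \<Prod>{n - Suc m + 1..n}"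
    using card_lists_distinct_length_eq[of S "Suc m"] S m by simp
  also have "real \<dots> = (\<Prod>k\<in>{n - m..n}. real k)"
    using m by (simp add: Suc_diff_Suc)
  also have "\<dots> \<ge> (\<Prod>k\<in>{n - m..n}. real n - real m)"
    using m by (intro prod_mono) auto
  finally show ?thesis using m by (simp add: Suc_diff_le)
qed

text \<open>Both sums become sums of indicators that a set of arcs is present, whose expectations
  are known. Squaring yields pairs of walks, and summing over \<open>j\<close> identifies their
  ends.\<close>

lemma sum_step_prob_adj:
  assumes "finite S" "i \<in> S"
  shows "(\<Sum>j\<in>S. step_prob S (adj E) m i j)
      = (\<Sum>xs\<in>lists_len S m. of_bool (walk_arcs i xs \<subseteq> E))" (is ?sum)
    and "(\<Sum>j\<in>S. (step_prob S (adj E) m i j)\<^sup>2)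
      = (\<Sum>xs\<in>lists_len S m. \<Sum>ys\<in>lists_len S m. of_bool (last (i # xs) = last (i # ys)) *
          of_bool (walk_arcs i xs \<union> walk_arcs i ys \<subseteq> E))" (is ?sq)
proof -
  have last_S: "last (i # xs) \<in> S" if "xs \<in> lists_len S m" for xs
  proof -
    have "last (i # xs) \<in> set (i # xs)" by (rule last_in_set) simp
    then show ?thesis using that assms(2) by (auto simp: lists_len_def)
  qed
  have one: "(\<Sum>j\<in>S. of_bool (v = j) * f j) = f v" if "v \<in> S" for v and f :: "'a \<Rightarrow> real"
    using that assms(1) by (simp add: of_bool_def if_distrib[where f = "\<lambda>z. z * _"] cong: if_cong)
  let ?w = "\<lambda>xs. of_bool (walk_arcs i xs \<subseteq> E) :: real"
  have "(\<Sum>j\<in>S. step_prob S (adj E) m i j)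
      = (\<Sum>xs\<in>lists_len S m. \<Sum>j\<in>S. of_bool (last (i # xs) = j) * ?w xs)"
    unfolding step_prob_adj[OF assms] by (rule sum.swap)
  also have "\<dots> = (\<Sum>xs\<in>lists_len S m. ?w xs)"
    by (intro sum.cong refl one last_S)
  finally show ?sum .
  have "(\<Sum>j\<in>S. (step_prob S (adj E) m i j)\<^sup>2)
      = (\<Sum>j\<in>S. \<Sum>xs\<in>lists_len S m. \<Sum>ys\<in>lists_len S m.
          of_bool (last (i # xs) = j) * (?w xs * (of_bool (last (i # ys) = j) * ?w ys)))"
    unfolding step_prob_adj[OF assms] power2_eq_square sum_product by (simp only: mult_ac)
  also have "\<dots> = (\<Sum>xs\<in>lists_len S m. \<Sum>j\<in>S. \<Sum>ys\<in>lists_len S m.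
          of_bool (last (i # xs) = j) * (?w xs * (of_bool (last (i # ys) = j) * ?w ys)))"
    by (rule sum.swap)
  also have "\<dots> = (\<Sum>xs\<in>lists_len S m. \<Sum>ys\<in>lists_len S m. \<Sum>j\<in>S.
          of_bool (last (i # xs) = j) * (?w xs * (of_bool (last (i # ys) = j) * ?w ys)))"
    by (intro sum.cong refl sum.swap)
  also have "\<dots> = (\<Sum>xs\<in>lists_len S m. \<Sum>ys\<in>lists_len S m.
          ?w xs * (of_bool (last (i # ys) = last (i # xs)) * ?w ys))"
    by (intro sum.cong refl one last_S)
  also have "\<dots> = (\<Sum>xs\<in>lists_len S m. \<Sum>ys\<in>lists_len S m. of_bool (last (i # xs) = last (i # ys)) *
          of_bool (walk_arcs i xs \<union> walk_arcs i ys \<subseteq> E))"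
    by (intro sum.cong refl) (auto simp: of_bool_def)
  finally show ?sq .
qed

subsection \<open>Moments of the step counts\<close>

abbreviation bernoulli_family :: "'a set \<Rightarrow> real \<Rightarrow> ('a \<Rightarrow> bool) pmf" where
  "bernoulli_family A p \<equiv> Pi_pmf A False (\<lambda>_. bernoulli_pmf p)"

text \<open>The default \<open>False\<close> outside the finite set \<open>A\<close> leaves only
  finitely many outcomes in the support.\<close>

lemma integrable_bernoulli_family [simp]:
  fixes f :: "_ \<Rightarrow> real"
  assumes "finite A"
  shows "integrable (measure_pmf (bernoulli_family A p)) f"
proof (rule integrable_measure_pmf_finite)
  have "set_pmf (bernoulli_family A p) \<subseteq> PiE_dflt A False (\<lambda>_. UNIV)"
    using set_Pi_pmf_subset'[OF assms, of False "\<lambda>_. bernoulli_pmf p"] by (auto simp: PiE_dflt_def)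
  then show "finite (set_pmf (bernoulli_family A p))"
    by (rule finite_subset) (use assms in \<open>auto intro: finite_PiE_dflt\<close>)
qed

text \<open>Independence gives a product over \<open>A\<close> in which the coordinates outside
  \<open>B\<close> contribute 1. It serves both for indicators of arc sets and for exponential
  moments.\<close>

lemma expectation_prod_bernoulli_family:
  fixes f :: "bool \<Rightarrow> real"
  assumes A: "finite A" "B \<subseteq> A" and p: "0 \<le> p" "p \<le> 1" and f: "\<And>b. 0 \<le> f b"
  shows "measure_pmf.expectation (bernoulli_family A p) (\<lambda>X. \<Prod>e\<in>B. f (X e))
    = (p * f True + (1 - p) * f False) ^ card B"
proof -
  let ?g = "\<lambda>e b. if e \<in> B then f b else 1"
  have "(\<Prod>e\<in>B. f (X e)) = (\<Prod>e\<in>A. ?g e (X e))" for X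
    using A by (intro prod.mono_neutral_cong_left) auto
  then have "measure_pmf.expectation (bernoulli_family A p) (\<lambda>X. \<Prod>e\<in>B. f (X e))
      = (\<Prod>e\<in>A. measure_pmf.expectation (bernoulli_pmf p) (?g e))"
    using A(1) f by (simp only:, subst expectation_prod_Pi_pmf)
      (auto intro!: integrable_measure_pmf_finite)
  also have "\<dots> = (\<Prod>e\<in>A. if e \<in> B then p * f True + (1 - p) * f False else 1)"
    using p by (intro prod.cong refl) (auto simp: mult_ac)
  also have "\<dots> = (\<Prod>e\<in>B. p * f True + (1 - p) * f False)"
    using A by (intro prod.mono_neutral_cong_right) auto
  finally show ?thesis by simp
qed

text \<open>The inequality covers walks that use a loop: an arc outside \<open>A\<close> is almost
  surely absent, so the expectation is 0.\<close>

lemma expectation_arcs_present: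
  assumes A: "finite A" and F: "finite F" and p: "0 \<le> p" "p \<le> 1"
  shows "F \<subseteq> A \<Longrightarrow>
      measure_pmf.expectation (bernoulli_family A p) (\<lambda>X. of_bool (F \<subseteq> {e. X e})) = p ^ card F"
    and "measure_pmf.expectation (bernoulli_family A p) (\<lambda>X. of_bool (F \<subseteq> {e. X e})) \<le> p ^ card F"
proof -
  have eq: "of_bool (F \<subseteq> {e. X e}) = (\<Prod>e\<in>F. of_bool (X e) :: real)" for X
    using F by (induction F rule: finite_induct) auto
  show *: "measure_pmf.expectation (bernoulli_family A p) (\<lambda>X. of_bool (F \<subseteq> {e. X e})) = p ^ card F"
    if "F \<subseteq> A"
    unfolding eq using expectation_prod_bernoulli_family[OF A that p, of of_bool] by simp
  show "measure_pmf.expectation (bernoulli_family A p) (\<lambda>X. of_bool (F \<subseteq> {e. X e})) \<le> p ^ card F"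
  proof (cases "F \<subseteq> A")
    case False
    then obtain e where e: "e \<in> F" "e \<notin> A" by blast
    have "measure_pmf.expectation (bernoulli_family A p) (\<lambda>X. of_bool (F \<subseteq> {e. X e}))
      = measure_pmf.expectation (bernoulli_family A p) (\<lambda>X. 0 :: real)"
      using e set_Pi_pmf_subset[OF A, of False "\<lambda>_. bernoulli_pmf p"]
      by (intro integral_cong_AE) (auto simp: AE_measure_pmf_iff)
    then show ?thesis using p by simp
  qed (use * in simp)
qed

abbreviation off_diagonal :: "'a set \<Rightarrow> ('a \<times> 'a) set" where
  "off_diagonal S \<equiv> {(i, j). i \<in> S \<and> j \<in> S \<and> i \<noteq> j}"

lemma finite_off_diagonal [simp]: "finite S \<Longrightarrow> finite (off_diagonal S)"
  by (rule finite_subset[of _ "S \<times> S"]) auto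

text \<open>Expanding the square around J / n gives the second moment, minus twice the normalised
  number of walks, plus 1. The first is bounded above by \<open>sum_walk_pairs_le\<close>, the
  number of walks below by \<open>sum_distinct_walks_ge\<close>. The leading parts 1 - 2 + 1 cancel
  as \<open>n\<close> grows.\<close>

lemma expectation_frobenius_le:
  assumes S: "finite S" "card S = n" "m < n" and p: "p \<le> 1"
    and d: "d = real n * p" "d \<ge> 1" and m: "m > 0"
  shows "measure_pmf.expectation (bernoulli_family (off_diagonal S) p)
      (\<lambda>X. \<Sum>i\<in>S. \<Sum>j\<in>S. (step_prob S (adj {e. X e}) m i j / d ^ m - 1 / real n)\<^sup>2)
    \<le> 2 + real (2 * m + 1) ^ (2 * m) * (1 / d + real n / d ^ m) - 2 * (1 - real m / real n) ^ Suc m"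
proof -
  let ?E = "measure_pmf.expectation (bernoulli_family (off_diagonal S) p)"
  let ?G = "\<lambda>X. \<Sum>i\<in>S. \<Sum>j\<in>S. (step_prob S (adj {e. X e}) m i j / d ^ m - 1 / real n)\<^sup>2"
  have n: "n > 0" using S by simp
  have p0: "p > 0" using d n by (metis less_le_trans zero_less_mult_pos zero_less_one of_nat_0_less_iff)
  define W where "W = (\<lambda>X i j. step_prob S (adj {e. X e}) m i j)"
  let ?W2 = "\<lambda>X. \<Sum>i\<in>S. \<Sum>j\<in>S. (W X i j)\<^sup>2" and ?W1 = "\<lambda>X. \<Sum>i\<in>S. \<Sum>j\<in>S. W X i j"
  have fin: "finite (off_diagonal S)" using S by simp
  note [simp] = integrable_bernoulli_family[OF fin]
  have G: "?G X = ?W2 X / d ^ (2 * m) - 2 / (n * d ^ m) * ?W1 X + 1" for X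
  proof -
    have "?G X = (\<Sum>i\<in>S. \<Sum>j\<in>S. (W X i j)\<^sup>2 / d ^ (2 * m) - 2 / (n * d ^ m) * W X i j + (1 / n)\<^sup>2)"
      by (intro sum.cong refl) (simp add: W_def power2_diff power_divide power_mult[symmetric] mult.commute)
    also have "\<dots> = ?W2 X / d ^ (2 * m) - 2 / (n * d ^ m) * ?W1 X + real n * (real n * (1 / n)\<^sup>2)"
      by (simp add: sum.distrib sum_subtractf sum_distrib_left sum_divide_distrib S(2))
    also have "real n * (real n * (1 / n)\<^sup>2) = 1"
      using n by (simp add: power2_eq_square)
    finally show ?thesis .
  qed
  have "?E ?W2 = (\<Sum>i\<in>S. \<Sum>xs\<in>lists_len S m. \<Sum>ys\<in>lists_len S m.
      of_bool (last (i # xs) = last (i # ys)) *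
      ?E (\<lambda>X. of_bool (walk_arcs i xs \<union> walk_arcs i ys \<subseteq> {e. X e})))"
    unfolding W_def by (simp add: sum_step_prob_adj S(1)
      del: sum_of_bool_mult_eq sum_mult_of_bool_eq sum_of_bool_eq Un_subset_iff last.simps cong: sum.cong)
  also have "\<dots> \<le> (\<Sum>i\<in>S. \<Sum>xs\<in>lists_len S m. \<Sum>ys\<in>lists_len S m.
      of_bool (last (i # xs) = last (i # ys)) * p ^ card (walk_arcs i xs \<union> walk_arcs i ys))"
    using fin p p0 by (intro sum_mono mult_left_mono expectation_arcs_present) auto
  also have "\<dots> \<le> d ^ (2 * m) * (1 + real (2 * m + 1) ^ (2 * m) * (1 / d + real n / d ^ m))"
    using S n d m by (intro sum_walk_pairs_le) auto
  finally have W2: "?E ?W2 / d ^ (2 * m) \<le> 1 + real (2 * m + 1) ^ (2 * m) * (1 / d + real n / d ^ m)"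
    using d by (simp add: divide_le_eq mult.commute)
  \<comment> \<open>Only walks without a repeated vertex are kept. They use exactly \<open>m\<close>
    distinct arcs and no loop, so each is present with probability \<open>p ^ m\<close>.\<close>
  have "(real n - real m) ^ Suc m * p ^ m
      \<le> (\<Sum>i\<in>S. \<Sum>xs\<in>lists_len S m. of_bool (distinct (i # xs))) * p ^ m"
    using p0 by (intro mult_right_mono sum_distinct_walks_ge S) auto
  also have "\<dots> = (\<Sum>i\<in>S. \<Sum>xs\<in>lists_len S m. of_bool (distinct (i # xs)) * p ^ m)"
    by (simp add: sum_distrib_right)
  also have "\<dots> \<le> (\<Sum>i\<in>S. \<Sum>xs\<in>lists_len S m. ?E (\<lambda>X. of_bool (walk_arcs i xs \<subseteq> {e. X e})))"
  proof (intro sum_mono)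
    fix i xs assume i: "i \<in> S" and xs: "xs \<in> lists_len S m"
    show "of_bool (distinct (i # xs)) * p ^ m \<le> ?E (\<lambda>X. of_bool (walk_arcs i xs \<subseteq> {e. X e}))"
    proof (cases "distinct (i # xs)")
      case True
      have "walk_arcs i xs \<subseteq> off_diagonal S"
        using walk_arcs_subset[of i xs] walk_arcs_distinct(2)[OF True] i xs
        by (fastforce simp: lists_len_def)
      from expectation_arcs_present(1)[OF fin finite_walk_arcs _ p this]
      have "?E (\<lambda>X. of_bool (walk_arcs i xs \<subseteq> {e. X e})) = p ^ m"
        using walk_arcs_distinct(1)[OF True] xs p0 by (simp add: lists_len_def)
      then show ?thesis using p0 by simp
    next
      case False
      then show ?thesis by (simp add: integral_nonneg_AE del: distinct.simps)
    qed
  qed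
  also have "\<dots> = ?E ?W1"
    unfolding W_def by (simp add: sum_step_prob_adj S(1) del: sum_of_bool_eq cong: sum.cong)
  finally have "2 / (n * d ^ m) * ((real n - real m) ^ Suc m * p ^ m) \<le> 2 / (n * d ^ m) * ?E ?W1"
    using d by (intro mult_left_mono) auto
  moreover have "2 / (n * d ^ m) * ((real n - real m) ^ Suc m * p ^ m) = 2 * (1 - real m / real n) ^ Suc m"
  proof -
    have "1 - real m / real n = (real n - real m) / n" using n by (simp add: field_simps)
    then show ?thesis using p0 n unfolding d(1) by (simp add: power_divide power_mult_distrib)
  qed
  ultimately have W1: "2 * (1 - real m / real n) ^ Suc m \<le> 2 / (n * d ^ m) * ?E ?W1" by simp
  have "?E ?G = ?E ?W2 / d ^ (2 * m) - 2 / (n * d ^ m) * ?E ?W1 + 1"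
    unfolding G by simp
  with W1 W2 show ?thesis by simp
qed

subsection \<open>Concentration of the out-degrees\<close>

text \<open>For negative \<open>s\<close>, multiply by \<open>1 - s\<close>: the product
  \<open>1 - s ^ 3\<close> is at least 1, while \<open>1 - s \<le> exp (- s)\<close>.\<close>

lemma exp_le_quadratic:
  fixes s :: real
  assumes "\<bar>s\<bar> \<le> 1"
  shows "exp s \<le> 1 + s + s\<^sup>2"
proof (cases "s \<ge> 0")
  case True
  then show ?thesis using exp_bound[of s] assms by simp
next
  case False
  have "(1 + s + s\<^sup>2) * (1 - s) = 1 - s ^ 3"
    by (simp add: algebra_simps power2_eq_square power3_eq_cube)
  moreover have "s ^ 3 \<le> 0" using False by simp
  ultimately have "1 \<le> (1 + s + s\<^sup>2) * (1 - s)" by simp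
  also have "\<dots> \<le> (1 + s + s\<^sup>2) * exp (- s)"
    using exp_ge_add_one_self[of "- s"] assms by (intro mult_left_mono) auto
  finally show ?thesis by (simp add: exp_minus field_simps)
qed

text \<open>Markov's inequality for the exponential moment, with 1 + x \<le> exp x in each factor.
  Allowing both signs of \<open>s\<close> yields both tails at once.\<close>

lemma bernoulli_sum_markov:
  fixes s a :: real
  assumes A: "finite A" "B \<subseteq> A" and p: "0 \<le> p" "p \<le> 1" and s: "\<bar>s\<bar> \<le> 1"
  shows "measure_pmf.prob (bernoulli_family A p) {X. s * (\<Sum>e\<in>B. of_bool (X e)) \<ge> a}
    \<le> exp (real (card B) * p * (s + s\<^sup>2) - a)"
proof -
  let ?M = "bernoulli_family A p" and ?Y = "\<lambda>X. \<Sum>e\<in>B. of_bool (X e) :: real"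
  have fB: "finite B" using A finite_subset by blast
  have "measure_pmf.prob ?M {X. s * ?Y X \<ge> a} = measure_pmf.prob ?M {X \<in> space ?M. exp (s * ?Y X) \<ge> exp a}"
    by simp
  also have "\<dots> \<le> measure_pmf.expectation ?M (\<lambda>X. exp (s * ?Y X)) / exp a"
    by (rule integral_Markov_inequality_measure[where A = "{}"]) (use A in auto)
  also have "measure_pmf.expectation ?M (\<lambda>X. exp (s * ?Y X)) = (p * exp s + (1 - p)) ^ card B"
    unfolding sum_distrib_left exp_sum[OF fB]
    using expectation_prod_bernoulli_family[OF A p, of "\<lambda>b. exp (s * of_bool b)"] by simp
  also have "\<dots> \<le> exp (p * (s + s\<^sup>2)) ^ card B"
  proof (rule power_mono)
    have "p * exp s + (1 - p) = 1 + p * (exp s - 1)" by (simp add: algebra_simps)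
    also have "\<dots> \<le> 1 + p * (s + s\<^sup>2)"
      using exp_le_quadratic[OF s] p by (intro add_left_mono mult_left_mono) auto
    also have "\<dots> \<le> exp (p * (s + s\<^sup>2))" by (rule exp_ge_add_one_self)
    finally show "p * exp s + (1 - p) \<le> exp (p * (s + s\<^sup>2))" .
  qed (use p in auto)
  also have "exp (p * (s + s\<^sup>2)) ^ card B = exp (real (card B) * p * (s + s\<^sup>2))"
    by (simp add: exp_of_nat_mult[symmetric] mult.assoc)
  finally show ?thesis by (simp add: exp_diff divide_right_mono)
qed

text \<open>Chernoff bounds with \<open>s = \<eta> / 2\<close> and \<open>s = - \<eta> / 2\<close>,
  for which d (s + s^2) minus the threshold is \<open>- \<eta>\<^sup>2 * d / 4\<close>.\<close>

lemma bernoulli_sum_concentration: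
  fixes \<eta> :: real
  assumes A: "finite A" "B \<subseteq> A" "Suc (card B) = n" and p: "0 \<le> p" "p \<le> 1"
    and d: "d = real n * p" and \<eta>: "0 \<le> \<eta>" "\<eta> \<le> 1"
  shows "measure_pmf.prob (bernoulli_family A p)
      {X. \<not> ((1 - \<eta>) * d \<le> (\<Sum>e\<in>B. of_bool (X e)) \<and> (\<Sum>e\<in>B. of_bool (X e)) \<le> (1 + \<eta>) * d)}
    \<le> 2 * exp (1 - \<eta>\<^sup>2 * d / 4)"
proof -
  let ?M = "bernoulli_family A p" and ?Y = "\<lambda>X. \<Sum>e\<in>B. of_bool (X e) :: real"
  let ?U = "{X. (\<eta> / 2) * ?Y X \<ge> (\<eta> / 2) * ((1 + \<eta>) * d)}"
  let ?L = "{X. (- (\<eta> / 2)) * ?Y X \<ge> (- (\<eta> / 2)) * ((1 - \<eta>) * d)}"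
  have cB: "real (card B) * p = d - p" using A(3) d by (auto simp: algebra_simps)
  have "measure_pmf.prob ?M {X. \<not> ((1 - \<eta>) * d \<le> ?Y X \<and> ?Y X \<le> (1 + \<eta>) * d)}
      \<le> measure_pmf.prob ?M (?U \<union> ?L)"
    using \<eta> by (intro measure_pmf.finite_measure_mono) (auto intro!: mult_left_mono)
  also have "\<dots> \<le> measure_pmf.prob ?M ?U + measure_pmf.prob ?M ?L"
    by (rule measure_Un_le) auto
  also have "measure_pmf.prob ?M ?U \<le> exp (1 - \<eta>\<^sup>2 * d / 4)"
  proof (rule order_trans[OF bernoulli_sum_markov[OF A(1,2) p]])
    have "0 \<le> p * (\<eta> / 2 + (\<eta> / 2)\<^sup>2)" using p \<eta> by simp
    then show "exp (real (card B) * p * (\<eta> / 2 + (\<eta> / 2)\<^sup>2) - \<eta> / 2 * ((1 + \<eta>) * d))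
      \<le> exp (1 - \<eta>\<^sup>2 * d / 4)"
      unfolding cB exp_le_cancel_iff by (simp add: field_simps power2_eq_square)
  qed (use \<eta> in auto)
  also have "measure_pmf.prob ?M ?L \<le> exp (1 - \<eta>\<^sup>2 * d / 4)"
  proof (rule order_trans[OF bernoulli_sum_markov[OF A(1,2) p]])
    \<comment> \<open>The mean is \<open>d - p\<close> because \<open>card B = n - 1\<close>. In the
      lower tail this leaves an excess of at most \<open>p * (\<eta> / 2)\<close>, which the 1 in
      the exponent absorbs.\<close>
    have "p * (\<eta> / 2) \<le> 1 * 1" using p \<eta> by (intro mult_mono) auto
    moreover have "0 \<le> p * (\<eta> / 2)\<^sup>2" using p by simp
    ultimately show "exp (real (card B) * p * (- (\<eta> / 2) + (- (\<eta> / 2))\<^sup>2) - - (\<eta> / 2) * ((1 - \<eta>) * d))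
      \<le> exp (1 - \<eta>\<^sup>2 * d / 4)"
      unfolding cB exp_le_cancel_iff by (simp add: field_simps power2_eq_square)
  qed (use \<eta> in auto)
  finally show ?thesis by simp
qed

subsection \<open>The chi-squared norm\<close>

abbreviation out_pairs :: "'a set \<Rightarrow> 'a \<Rightarrow> ('a \<times> 'a) set" where
  "out_pairs S i \<equiv> {i} \<times> (S - {i})"

text \<open>The deterministic part: a fixed graph whose out-degrees are near \<open>d\<close> and
  whose scaled walk counts are near J / n. It chains \<open>step_prob_walk_approx\<close>,
  \<open>frobenius_dist_perturb\<close> and \<open>stationary_dist_uniform_le\<close>.\<close>

lemma chi_squared_norm_stationary_le:
  fixes X :: "nat \<times> nat \<Rightarrow> bool" and n :: nat
  defines "S \<equiv> {1..n}" and "D \<equiv> \<lambda>i. \<Sum>e\<in>out_pairs {1..n} i. of_bool (X e) :: real"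
    and "G \<equiv> \<lparr>verts = {1..n}, arcs = {e. X e}, tail = fst, head = snd\<rparr>"
  assumes X: "\<And>e. X e \<Longrightarrow> e \<in> off_diagonal S" and n: "n > 0" and d: "d > 0"
    and \<eta>: "0 \<le> \<eta>" "\<eta> < 1" and D: "\<And>i. i \<in> S \<Longrightarrow> (1 - \<eta>) * d \<le> D i \<and> D i \<le> (1 + \<eta>) * d"
    and \<kappa>: "\<kappa> = (1 / (1 - \<eta>)) ^ m - (1 / (1 + \<eta>)) ^ m"
    and \<gamma>: "(\<Sum>i\<in>S. \<Sum>j\<in>S. (step_prob S (adj {e. X e}) m i j / d ^ m - 1 / real n)\<^sup>2) \<le> \<gamma>"
    and \<delta>: "0 \<le> \<delta>" and \<epsilon>: "2 * \<gamma> + 4 * \<kappa>\<^sup>2 * (\<gamma> + 1) \<le> min (1 / 2) (\<delta>\<^sup>2 / 2)"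
    and erg: "irreducible_ergodic S (random_walk G)"
  shows "chi_squared_norm S (\<lambda>_. 1 / real n)
    (\<lambda>i. stationary_distribution S (random_walk G) i - 1 / real n) \<le> \<delta>"
proof -
  let ?P = "random_walk G" and ?b = "\<lambda>i j. step_prob S (adj {e. X e}) m i j / d ^ m"
  define g where "g = (\<Sum>i\<in>S. \<Sum>j\<in>S. (?b i j - 1 / real n)\<^sup>2)"
  define F where "F = (\<Sum>i\<in>S. \<Sum>j\<in>S. (step_prob S ?P m i j - 1 / real n)\<^sup>2)"
  have S: "finite S" "card S = n" by (auto simp: S_def)
  have "real (out_degree G i) = D i" if "i \<in> S" for i
  proof -
    have "out_arcs G i = out_pairs {1..n} i \<inter> {e. X e}"
      using X by (fastforce simp: out_arcs_def G_def S_def)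
    then show ?thesis by (simp add: out_degree_def D_def)
  qed
  then have P: "?P i j = adj {e. X e} i j / D i" if "i \<in> S" "j \<in> S" for i j
    using that by (auto simp: random_walk_def adj_def G_def arcs_ends_def arc_to_ends_def)
  have "F \<le> 2 * g + 4 * \<kappa>\<^sup>2 * (g + 1)"
    unfolding F_def
  proof (rule frobenius_dist_perturb[OF S(2) n _ g_def])
    show "\<bar>step_prob S ?P m i j - ?b i j\<bar> \<le> \<kappa> * ?b i j" if "i \<in> S" "j \<in> S" for i j
      unfolding \<kappa> using step_prob_walk_approx[OF d \<eta> D P that(1)] .
  qed
  also have "\<dots> \<le> 2 * \<gamma> + 4 * \<kappa>\<^sup>2 * (\<gamma> + 1)"
    using \<gamma> unfolding g_def by (intro add_mono mult_left_mono) auto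
  \<comment> \<open>The minimum combines the bound 1/2 needed for the absorption in
    \<open>stationary_dist_uniform_le\<close> with the final bound on \<open>2 * F\<close>.\<close>
  finally have F: "F \<le> 1 / 2" "2 * F \<le> \<delta>\<^sup>2" using \<epsilon> by auto
  have "is_stationary S ?P (stationary_distribution S ?P)"
    using erg by (intro stationary_distribution_is_stationary) (auto simp: irreducible_ergodic_def)
  from stationary_dist_uniform_le[OF S n this F_def F(1)] F(2)
  have "(\<Sum>i\<in>S. (stationary_distribution S ?P i - 1 / real n)\<^sup>2 / (1 / real n)) \<le> \<delta>\<^sup>2"
    by (simp add: sum_distrib_left mult.commute)
  then show ?thesis
    unfolding chi_squared_norm_def using \<delta> by (intro real_le_lsqrt) auto
qed

text \<open>A bad graph has either a Frobenius distance of at least \<gamma>, controlled by Markov's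
  inequality, or a vertex with deviating out-degree, controlled by a union bound over
  \<open>n\<close> vertices.\<close>

lemma prob_chi_squared_norm_le:
  assumes p: "p \<le> 1" and d: "d = real n * p" "d \<ge> 1" and m: "m > 0" "m < n"
    and \<eta>: "0 \<le> \<eta>" "\<eta> < 1" and \<kappa>: "\<kappa> = (1 / (1 - \<eta>)) ^ m - (1 / (1 + \<eta>)) ^ m"
    and \<gamma>: "\<gamma> > 0" and \<delta>: "0 \<le> \<delta>" and \<epsilon>: "2 * \<gamma> + 4 * \<kappa>\<^sup>2 * (\<gamma> + 1) \<le> min (1 / 2) (\<delta>\<^sup>2 / 2)"
  shows "measure_pmf.prob (random_digraph n p)
           {G. irreducible_ergodic (verts G) (random_walk G) \<and>
               chi_squared_norm (verts G) (\<lambda>_. 1 / real n)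
                 (\<lambda>i. stationary_distribution (verts G) (random_walk G) i - 1 / real n) > \<delta>}
    \<le> (2 + real (2 * m + 1) ^ (2 * m) * (1 / d + real n / d ^ m) - 2 * (1 - real m / real n) ^ Suc m) / \<gamma>
      + real n * (2 * exp (1 - \<eta>\<^sup>2 * d / 4))"
proof -
  let ?S = "{1..n}" and ?D = "\<lambda>X i. \<Sum>e\<in>out_pairs {1..n} i. of_bool (X e) :: real"
  let ?M = "bernoulli_family (off_diagonal ?S) p"
  define G where "G = (\<lambda>X::nat \<times> nat \<Rightarrow> bool. \<lparr>verts = ?S, arcs = {e. X e}, tail = fst, head = snd\<rparr>)"
  define F where "F = (\<lambda>X. \<Sum>i\<in>?S. \<Sum>j\<in>?S.
    (step_prob ?S (adj {e. X e}) m i j / d ^ m - 1 / real n)\<^sup>2)"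
  let ?Bad = "{G. irreducible_ergodic (verts G) (random_walk G) \<and>
               chi_squared_norm (verts G) (\<lambda>_. 1 / real n)
                 (\<lambda>i. stationary_distribution (verts G) (random_walk G) i - 1 / real n) > \<delta>}"
  let ?B = "\<lambda>i. {X. \<not> ((1 - \<eta>) * d \<le> ?D X i \<and> ?D X i \<le> (1 + \<eta>) * d)}"
  have p0: "0 \<le> p" using d m by (metis gr_implies_not0 mult_le_0_iff not_one_le_zero
    linorder_le_cases of_nat_0_le_iff order_trans)
  have n: "n > 0" using m by simp
  have F0: "0 \<le> F X" for X
    by (simp add: F_def sum_nonneg)
  have fin: "finite (off_diagonal ?S)" by (rule finite_off_diagonal) simp
  have int: "integrable (measure_pmf ?M) F"
    by (rule integrable_bernoulli_family[OF fin])
  have supp: "e \<in> off_diagonal ?S" if "X \<in> set_pmf ?M" "X e" for X e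
    using subsetD[OF set_Pi_pmf_subset[OF fin] that(1)] that(2)
    by blast
  have "measure_pmf.prob (random_digraph n p) ?Bad = measure_pmf.prob ?M (G -` ?Bad)"
    unfolding random_digraph_def G_def by (rule measure_map_pmf)
  also have "\<dots> \<le> measure_pmf.prob ?M ({X. F X \<ge> \<gamma>} \<union> (\<Union>i\<in>?S. ?B i))"
  proof (rule measure_pmf.finite_measure_mono_AE)
    \<comment> \<open>The inclusion is shown on the support only, where no arc is a loop or leaves
      the vertex set.\<close>
    have "X \<in> {X. F X \<ge> \<gamma>} \<union> (\<Union>i\<in>?S. ?B i)" if X: "X \<in> set_pmf ?M" "X \<in> G -` ?Bad" for X
    proof (rule ccontr)
      assume "X \<notin> {X. F X \<ge> \<gamma>} \<union> (\<Union>i\<in>?S. ?B i)"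
      then have F: "F X \<le> \<gamma>" and D: "\<And>i. i \<in> ?S \<Longrightarrow> (1 - \<eta>) * d \<le> ?D X i \<and> ?D X i \<le> (1 + \<eta>) * d"
        by auto
      have d0: "d > 0" using d(2) by simp
      have erg: "irreducible_ergodic ?S (random_walk (G X))" using X(2) by (simp add: G_def)
      have "chi_squared_norm ?S (\<lambda>_. 1 / real n)
          (\<lambda>i. stationary_distribution ?S (random_walk (G X)) i - 1 / real n) \<le> \<delta>"
        unfolding G_def
        by (rule chi_squared_norm_stationary_le[OF supp[OF X(1)] n d0 \<eta> D \<kappa> F[unfolded F_def] \<delta> \<epsilon>
              erg[unfolded G_def]])
      then show False using X(2) by (simp add: G_def)
    qed
    then show "AE X in ?M. X \<in> G -` ?Bad \<longrightarrow> X \<in> {X. F X \<ge> \<gamma>} \<union> (\<Union>i\<in>?S. ?B i)"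
      by (simp only: AE_measure_pmf_iff) blast
  qed simp
  also have "\<dots> \<le> measure_pmf.prob ?M {X. F X \<ge> \<gamma>} + measure_pmf.prob ?M (\<Union>i\<in>?S. ?B i)"
    by (rule measure_Un_le) auto
  also have "measure_pmf.prob ?M {X. F X \<ge> \<gamma>} \<le> measure_pmf.expectation ?M F / \<gamma>"
    using integral_Markov_inequality_measure[OF int, of "{}" \<gamma>] F0 \<gamma> by simp
  also have "measure_pmf.expectation ?M F \<le> 2 + real (2 * m + 1) ^ (2 * m) * (1 / d + real n / d ^ m)
      - 2 * (1 - real m / real n) ^ Suc m"
    unfolding F_def using p d m by (intro expectation_frobenius_le) auto
  also have "measure_pmf.prob ?M (\<Union>i\<in>?S. ?B i) \<le> (\<Sum>i\<in>?S. measure_pmf.prob ?M (?B i))"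
    by (rule measure_UNION_le) auto
  also have "\<dots> \<le> (\<Sum>i\<in>?S. 2 * exp (1 - \<eta>\<^sup>2 * d / 4))"
  proof (rule sum_mono)
    fix i assume i: "i \<in> ?S"
    have "Suc (card (out_pairs ?S i)) = n"
      using i by (simp add: card_cartesian_product)
    with i show "measure_pmf.prob ?M (?B i) \<le> 2 * exp (1 - \<eta>\<^sup>2 * d / 4)"
      using p p0 d \<eta> by (intro bernoulli_sum_concentration fin) auto
  qed
  also have "\<dots> = real n * (2 * exp (1 - \<eta>\<^sup>2 * d / 4))" by simp
  finally show ?thesis using \<gamma> by (simp add: divide_right_mono)
qed

section \<open>Choice of the parameters and passage to the limit\<close>

theorem corollary1:
  fixes k :: real and p :: "nat \<Rightarrow> real"
  assumes "k > 0"
    and "\<And>n. 0 \<le> p n \<and> p n \<le> 1"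
    and "\<forall>\<^sub>F n in sequentially. p n > 0"
    and "(\<lambda>n. real n powr (-1 + k) / p n) \<longlonglongrightarrow> 0"
  shows "\<forall>\<delta>>0.
    (\<lambda>n. measure_pmf.prob (random_digraph n (p n))
           {G. irreducible_ergodic (verts G) (random_walk G) \<and>
               chi_squared_norm (verts G) (\<lambda>_. 1 / real n)
                 (\<lambda>i. stationary_distribution (verts G) (random_walk G) i - 1 / real n) > \<delta>})
      \<longlonglongrightarrow> 0"
proof (intro allI impI)
  fix \<delta> :: real assume \<delta>: "\<delta> > 0"
  define m where "m = nat \<lceil>2 / k\<rceil>"
  define \<epsilon> where "\<epsilon> = min (1 / 2) (\<delta>\<^sup>2 / 2)"
  \<comment> \<open>Then \<open>2 * \<gamma>\<close> is half of \<epsilon>. The choice of \<eta>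
    below makes \<open>4 * \<kappa>\<^sup>2\<close> less than a quarter of \<epsilon>, and
    \<open>\<gamma> + 1 \<le> 2\<close>, so the rest fits into the other half.\<close>
  define \<gamma> where "\<gamma> = \<epsilon> / 4"
  have \<epsilon>: "0 < \<epsilon>" "\<epsilon> \<le> 1 / 2" using \<delta> by (auto simp: \<epsilon>_def)
  have "2 / k > 0" using \<open>k > 0\<close> by simp
  then have "0 < \<lceil>2 / k\<rceil>" by simp
  then have m0: "m > 0" and "real m \<ge> 2 / k" unfolding m_def by linarith+
  then have mk: "k * real m \<ge> 2" using \<open>k > 0\<close> by (simp add: field_simps)
  \<comment> \<open>\<kappa> is continuous in \<eta> and vanishes at 0, so a small positive \<eta>
    makes it as small as required.\<close>
  have "((\<lambda>\<eta>::real. 4 * ((1 / (1 - \<eta>)) ^ m - (1 / (1 + \<eta>)) ^ m)\<^sup>2) \<longlongrightarrow>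
      4 * ((1 / (1 - 0)) ^ m - (1 / (1 + 0)) ^ m)\<^sup>2) (at_right 0)"
    by (intro tendsto_intros) auto
  then have "\<forall>\<^sub>F \<eta>::real in at_right 0. 4 * ((1 / (1 - \<eta>)) ^ m - (1 / (1 + \<eta>)) ^ m)\<^sup>2 < \<epsilon> / 4"
    by (rule order_tendstoD) (use \<epsilon> in simp)
  moreover have "\<forall>\<^sub>F \<eta>::real in at_right 0. 0 < \<eta> \<and> \<eta> < 1"
    unfolding eventually_at_right_field by (intro exI[of _ 1]) auto
  ultimately have "\<forall>\<^sub>F \<eta>::real in at_right 0.
      4 * ((1 / (1 - \<eta>)) ^ m - (1 / (1 + \<eta>)) ^ m)\<^sup>2 < \<epsilon> / 4 \<and> 0 < \<eta> \<and> \<eta> < 1"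
    by (rule eventually_conj)
  then obtain \<eta> :: real where \<eta>: "4 * ((1 / (1 - \<eta>)) ^ m - (1 / (1 + \<eta>)) ^ m)\<^sup>2 < \<epsilon> / 4" "0 < \<eta>" "\<eta> < 1"
    using eventually_happens[of _ "at_right (0::real)"] by auto
  define \<kappa> where "\<kappa> = (1 / (1 - \<eta>)) ^ m - (1 / (1 + \<eta>)) ^ m"
  have "4 * \<kappa>\<^sup>2 * (\<gamma> + 1) \<le> \<epsilon> / 4 * 2"
    using \<eta> \<epsilon> by (intro mult_mono) (auto simp: \<kappa>_def \<gamma>_def)
  then have small: "2 * \<gamma> + 4 * \<kappa>\<^sup>2 * (\<gamma> + 1) \<le> min (1 / 2) (\<delta>\<^sup>2 / 2)"
    unfolding \<epsilon>_def[symmetric] by (simp add: \<gamma>_def)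
  define d where "d = (\<lambda>n. real n * p n)"
  let ?c = "real (2 * m + 1) ^ (2 * m)"
  \<comment> \<open>The bound of \<open>prob_chi_squared_norm_le\<close> with \<open>d n\<close>
    replaced by its lower bound \<open>n powr k\<close>, and \<open>n / d n ^ m\<close> by
    \<open>1 / n\<close>, which \<open>k * m \<ge> 2\<close> permits.\<close>
  let ?h = "\<lambda>n. (2 + ?c * (1 / real n powr k + 1 / real n) - 2 * (1 - real m / real n) ^ Suc m) / \<gamma>
      + real n * (2 * exp (1 - \<eta>\<^sup>2 * real n powr k / 4))"
  \<comment> \<open>A ratio below 1 already gives \<open>d n \<ge> n powr k\<close>; multiply by
    \<open>n\<close>.\<close>
  have "\<forall>\<^sub>F n in sequentially. real n powr (-1 + k) / p n < 1"
    using assms(4) by (rule order_tendstoD) simp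
  then have d_ge: "\<forall>\<^sub>F n in sequentially. real n powr k \<le> d n"
    using assms(3) eventually_gt_at_top[of 0]
  proof eventually_elim
    case (elim n)
    have "real n powr k = real n * real n powr (-1 + k)"
      using elim powr_add[of "real n" 1 "-1 + k"] by simp
    also have "\<dots> \<le> real n * p n" using elim by (intro mult_left_mono) (auto simp: field_simps)
    finally show ?case by (simp add: d_def)
  qed
  show "(\<lambda>n. measure_pmf.prob (random_digraph n (p n))
           {G. irreducible_ergodic (verts G) (random_walk G) \<and>
               chi_squared_norm (verts G) (\<lambda>_. 1 / real n)
                 (\<lambda>i. stationary_distribution (verts G) (random_walk G) i - 1 / real n) > \<delta>})
      \<longlonglongrightarrow> 0"
  proof (rule tendsto_sandwich[where f = "\<lambda>_. 0" and h = ?h])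
    show "\<forall>\<^sub>F n in sequentially. measure_pmf.prob (random_digraph n (p n))
           {G. irreducible_ergodic (verts G) (random_walk G) \<and>
               chi_squared_norm (verts G) (\<lambda>_. 1 / real n)
                 (\<lambda>i. stationary_distribution (verts G) (random_walk G) i - 1 / real n) > \<delta>} \<le> ?h n"
      using d_ge eventually_gt_at_top[of m]
    proof eventually_elim
      case (elim n)
      let ?q = "real n powr k"
      have n: "real n \<ge> 1" using elim by simp
      have q: "?q \<ge> 1" using n \<open>k > 0\<close> by (simp add: ge_one_powr_ge_zero)
      have "real n / d n ^ m \<le> real n / ?q ^ m"
        using elim q by (intro divide_left_mono power_mono mult_pos_pos zero_less_power) auto
      also have "?q ^ m = real n powr (k * real m)"
        using n by (simp add: powr_powr flip: powr_realpow)
      also have "real n / real n powr (k * real m) \<le> real n / real n powr 2"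
        using n mk by (intro divide_left_mono powr_mono) auto
      also have "\<dots> = 1 / real n" using n by (simp add: power2_eq_square)
      finally have 1: "real n / d n ^ m \<le> 1 / real n" .
      have 2: "1 / d n \<le> 1 / ?q" using elim q by (intro divide_left_mono) auto
      have 3: "\<eta>\<^sup>2 * ?q / 4 \<le> \<eta>\<^sup>2 * d n / 4"
        using elim by (intro divide_right_mono mult_left_mono) auto
      have "measure_pmf.prob (random_digraph n (p n))
           {G. irreducible_ergodic (verts G) (random_walk G) \<and>
               chi_squared_norm (verts G) (\<lambda>_. 1 / real n)
                 (\<lambda>i. stationary_distribution (verts G) (random_walk G) i - 1 / real n) > \<delta>}
        \<le> (2 + ?c * (1 / d n + real n / d n ^ m) - 2 * (1 - real m / real n) ^ Suc m) / \<gamma>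
          + real n * (2 * exp (1 - \<eta>\<^sup>2 * d n / 4))"
        by (rule prob_chi_squared_norm_le[OF _ d_def[THEN fun_cong] _ m0 _ _ \<eta>(3) \<kappa>_def _ _ small])
          (use assms(2) elim q \<eta> \<epsilon> \<delta> in \<open>auto simp: \<gamma>_def\<close>)
      also have "\<dots> \<le> ?h n"
        using 1 2 3 \<epsilon> by (intro add_mono divide_right_mono diff_mono mult_left_mono) (auto simp: \<gamma>_def)
      finally show ?case .
    qed
    have "(\<lambda>n. real n * (2 * exp (1 - \<eta>\<^sup>2 * real n powr k / 4))) \<longlonglongrightarrow> 0"
      using \<open>k > 0\<close> \<eta>(2) by real_asymp
    moreover have "(\<lambda>n. 1 / real n powr k) \<longlonglongrightarrow> 0"
      using \<open>k > 0\<close> by real_asymp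
    moreover have "(\<lambda>n. real m / real n) \<longlonglongrightarrow> 0" "(\<lambda>n. 1 / real n) \<longlonglongrightarrow> 0"
      by real_asymp+
    \<comment> \<open>The numerator tends to 2 - 2 = 0, and the exponential in
      \<open>n powr k\<close> outweighs the factor \<open>n\<close> from the union bound.\<close>
    ultimately have "?h \<longlonglongrightarrow> (2 + ?c * (0 + 0) - 2 * (1 - 0) ^ Suc m) / \<gamma> + 0"
      by (intro tendsto_intros) (use \<epsilon> in \<open>auto simp: \<gamma>_def\<close>)
    then show "?h \<longlonglongrightarrow> 0" by simp
  qed auto
qed

end
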